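(* Let $(M,\varphi,\xi,\eta,g)$ be a regular $f$-Kenmotsu manifold which is locally Ricci symmetric, i.e. its Ricci tensor $S$ satisfies $\nabla S=0$, where $\nabla$ is the Levi-Civita connection of $g$. Then $(M,g)$ is an Einstein manifold, i.e. $S=c\,g$ for some real constant $c$.
   Context: All objects are $C^\infty$; manifolds are connected. An almost contact metric manifold is a $(2n+1)$-dimensional manifold $M$ ($n\ge 1$) with a $(1,1)$-tensor field $\varphi$, a vector field $\xi$, a 1-form $\eta$ and a Riemannian metric $g$ such that $\varphi^2=-I+\eta\otimes\xi$, $\eta(\xi)=1$, $\eta\circ\varphi=0$, $\varphi(\xi)=0$, $\eta(X)=g(X,\xi)$ and $g(\varphi X,\varphi Y)=g(X,Y)-\eta(X)\eta(Y)$ for all vector fields $X,Y$. It is an $f$-Kenmotsu manifold if its Levi-Civita connection $\nabla$ satisfies $(\nabla_X\varphi)(Y)=f\,(g(\varphi X,Y)\xi-\varphi(X)\eta(Y))$ for all $X,Y$, where $f\in C^\infty(M)$ is strictly positive and $df\wedge\eta=0$. An $f$-Kenmotsu manifold is regular if $f^2+\xi(f)\neq 0$ at every point of $M$. *)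

theory Defs
  imports "HOL-Analysis.Analysis"
begin

text \<open>
  \<open>times_differentiable_on k S f\<close>: on the open set \<open>S\<close>, all iterated directional derivatives of
  \<open>f\<close> of order up to \<open>k\<close> exist and are continuous, i.e. \<open>f\<close> is of class \<open>C\<^sup>k\<close>.
\<close>

primrec times_differentiable_on ::
  "nat \<Rightarrow> 'a::real_normed_vector set \<Rightarrow> ('a \<Rightarrow> 'b::real_normed_vector) \<Rightarrow> bool" where
  "times_differentiable_on 0 S f \<longleftrightarrow> continuous_on S f"
| "times_differentiable_on (Suc k) S f \<longleftrightarrow>
     (\<forall>x\<in>S. f differentiable (at x)) \<and>
     (\<forall>v. times_differentiable_on k S (\<lambda>x. frechet_derivative f (at x) v))"

definition smooth_on ::
  "'a::real_normed_vector set \<Rightarrow> ('a \<Rightarrow> 'b::real_normed_vector) \<Rightarrow> bool" where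
  "smooth_on S f \<longleftrightarrow> (\<forall>k. times_differentiable_on k S f)"

text \<open>
  The underlying space of a manifold is the whole type \<open>'m\<close>, which is required to be Hausdorff and
  second countable. A chart is a pair \<open>(U, x)\<close>; the values of \<open>x\<close> outside \<open>U\<close> are irrelevant.
  The atlas need not be maximal: all notions below depend only on the smooth structure it generates.
\<close>

type_synonym ('m, 'n) chart = "'m set \<times> ('m \<Rightarrow> real ^ 'n)"

abbreviation chart_image :: "('m, 'n) chart \<Rightarrow> (real ^ 'n) set" where
  "chart_image c \<equiv> snd c ` fst c"

abbreviation chart_inv :: "('m, 'n) chart \<Rightarrow> real ^ 'n \<Rightarrow> 'm" where
  "chart_inv c \<equiv> inv_into (fst c) (snd c)"

definition is_chart :: "('m::topological_space, 'n::finite) chart \<Rightarrow> bool" where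
  "is_chart c \<longleftrightarrow> open (fst c) \<and> open (chart_image c) \<and>
     homeomorphism (fst c) (chart_image c) (snd c) (chart_inv c)"

definition smooth_atlas ::
  "('m::{t2_space, second_countable_topology}, 'n::finite) chart set \<Rightarrow> bool" where
  "smooth_atlas A \<longleftrightarrow>
     (\<forall>c\<in>A. is_chart c) \<and> (\<Union>c\<in>A. fst c) = UNIV \<and>
     (\<forall>c\<in>A. \<forall>c'\<in>A. smooth_on (snd c ` (fst c \<inter> fst c')) (snd c' \<circ> chart_inv c))"

definition smooth_function ::
  "('m, 'n::finite) chart set \<Rightarrow> ('m \<Rightarrow> real) \<Rightarrow> bool" where
  "smooth_function A f \<longleftrightarrow> (\<forall>c\<in>A. smooth_on (chart_image c) (f \<circ> chart_inv c))"

text \<open>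
  For each point \<open>p\<close> one chart \<open>chart_at A p\<close> around \<open>p\<close> is chosen once and for all, and the tangent
  space at \<open>p\<close> is represented by \<open>real ^ 'n\<close>: a tangent vector is given by its components in that
  chart. \<open>tangent_comp A c p v\<close> are the components of the same tangent vector in another
  chart \<open>c\<close> around \<open>p\<close>. Consequently a vector field has type \<open>'m \<Rightarrow> real ^ 'n\<close>, but its
  smoothness must be tested through its components in the charts: the choice of \<open>chart_at A p\<close>
  does not depend continuously on \<open>p\<close>.
\<close>

definition chart_at :: "('m, 'n) chart set \<Rightarrow> 'm \<Rightarrow> ('m, 'n) chart" where
  "chart_at A p = (SOME c. c \<in> A \<and> p \<in> fst c)"

definition tangent_comp ::
  "('m, 'n::finite) chart set \<Rightarrow> ('m, 'n) chart \<Rightarrow> 'm \<Rightarrow> real ^ 'n \<Rightarrow> real ^ 'n" where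
  "tangent_comp A c p v =
     frechet_derivative (snd c \<circ> chart_inv (chart_at A p)) (at (snd (chart_at A p) p)) v"

definition smooth_vector_field ::
  "('m, 'n::finite) chart set \<Rightarrow> ('m \<Rightarrow> real ^ 'n) \<Rightarrow> bool" where
  "smooth_vector_field A X \<longleftrightarrow>
     (\<forall>c\<in>A. smooth_on (chart_image c) ((\<lambda>p. tangent_comp A c p (X p)) \<circ> chart_inv c))"

definition differential ::
  "('m, 'n::finite) chart set \<Rightarrow> ('m \<Rightarrow> real) \<Rightarrow> 'm \<Rightarrow> real ^ 'n \<Rightarrow> real" where
  "differential A f p v =
     frechet_derivative (f \<circ> chart_inv (chart_at A p)) (at (snd (chart_at A p) p)) v"

definition vf_derivative ::
  "('m, 'n::finite) chart set \<Rightarrow> ('m \<Rightarrow> real ^ 'n) \<Rightarrow> ('m \<Rightarrow> real) \<Rightarrow> 'm \<Rightarrow> real" where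
  "vf_derivative A X f p = differential A f p (X p)"

definition lie_bracket ::
  "('m, 'n::finite) chart set \<Rightarrow> ('m \<Rightarrow> real ^ 'n) \<Rightarrow> ('m \<Rightarrow> real ^ 'n) \<Rightarrow> 'm \<Rightarrow> real ^ 'n" where
  "lie_bracket A X Y = (THE Z. smooth_vector_field A Z \<and>
     (\<forall>f. smooth_function A f \<longrightarrow> (\<forall>p. vf_derivative A Z f p =
        vf_derivative A X (vf_derivative A Y f) p - vf_derivative A Y (vf_derivative A X f) p)))"

text \<open>
  Tensor fields are given pointwise on tangent spaces. They are smooth iff they
  produce smooth functions or vector fields from smooth vector fields.
\<close>

definition one_form ::
  "('m, 'n::finite) chart set \<Rightarrow> ('m \<Rightarrow> real ^ 'n \<Rightarrow> real) \<Rightarrow> bool" where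
  "one_form A \<alpha> \<longleftrightarrow> (\<forall>p. linear (\<alpha> p)) \<and>
     (\<forall>X. smooth_vector_field A X \<longrightarrow> smooth_function A (\<lambda>p. \<alpha> p (X p)))"

definition endomorphism_field ::
  "('m, 'n::finite) chart set \<Rightarrow> ('m \<Rightarrow> real ^ 'n \<Rightarrow> real ^ 'n) \<Rightarrow> bool" where
  "endomorphism_field A T \<longleftrightarrow> (\<forall>p. linear (T p)) \<and>
     (\<forall>X. smooth_vector_field A X \<longrightarrow> smooth_vector_field A (\<lambda>p. T p (X p)))"

definition wedge ::
  "('m \<Rightarrow> real ^ 'n \<Rightarrow> real) \<Rightarrow> ('m \<Rightarrow> real ^ 'n \<Rightarrow> real) \<Rightarrow> 'm \<Rightarrow> real ^ 'n \<Rightarrow> real ^ 'n \<Rightarrow> real" where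
  "wedge \<alpha> \<beta> p u v = \<alpha> p u * \<beta> p v - \<alpha> p v * \<beta> p u"

definition riemannian_metric ::
  "('m, 'n::finite) chart set \<Rightarrow> ('m \<Rightarrow> real ^ 'n \<Rightarrow> real ^ 'n \<Rightarrow> real) \<Rightarrow> bool" where
  "riemannian_metric A g \<longleftrightarrow>
     (\<forall>p. bilinear (g p) \<and> (\<forall>u v. g p u v = g p v u) \<and> (\<forall>u. u \<noteq> 0 \<longrightarrow> 0 < g p u u)) \<and>
     (\<forall>X Y. smooth_vector_field A X \<and> smooth_vector_field A Y \<longrightarrow>
        smooth_function A (\<lambda>p. g p (X p) (Y p)))"

text \<open>
  A connection is an operation on smooth vector fields; its values on non-smooth arguments are
  unconstrained and never used.
\<close>

type_synonym ('m, 'n) connection =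
  "('m \<Rightarrow> real ^ 'n) \<Rightarrow> ('m \<Rightarrow> real ^ 'n) \<Rightarrow> 'm \<Rightarrow> real ^ 'n"

definition affine_connection ::
  "('m, 'n::finite) chart set \<Rightarrow> ('m, 'n) connection \<Rightarrow> bool" where
  "affine_connection A D \<longleftrightarrow>
     (\<forall>X Y. smooth_vector_field A X \<and> smooth_vector_field A Y \<longrightarrow> smooth_vector_field A (D X Y)) \<and>
     (\<forall>X X' Y. smooth_vector_field A X \<and> smooth_vector_field A X' \<and> smooth_vector_field A Y \<longrightarrow>
        D (\<lambda>p. X p + X' p) Y = (\<lambda>p. D X Y p + D X' Y p)) \<and>
     (\<forall>f X Y. smooth_function A f \<and> smooth_vector_field A X \<and> smooth_vector_field A Y \<longrightarrow>
        D (\<lambda>p. f p *\<^sub>R X p) Y = (\<lambda>p. f p *\<^sub>R D X Y p)) \<and>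
     (\<forall>X Y Y'. smooth_vector_field A X \<and> smooth_vector_field A Y \<and> smooth_vector_field A Y' \<longrightarrow>
        D X (\<lambda>p. Y p + Y' p) = (\<lambda>p. D X Y p + D X Y' p)) \<and>
     (\<forall>f X Y. smooth_function A f \<and> smooth_vector_field A X \<and> smooth_vector_field A Y \<longrightarrow>
        D X (\<lambda>p. f p *\<^sub>R Y p) = (\<lambda>p. vf_derivative A X f p *\<^sub>R Y p + f p *\<^sub>R D X Y p))"

definition torsion_free :: "('m, 'n::finite) chart set \<Rightarrow> ('m, 'n) connection \<Rightarrow> bool" where
  "torsion_free A D \<longleftrightarrow>
     (\<forall>X Y. smooth_vector_field A X \<and> smooth_vector_field A Y \<longrightarrow>
        (\<forall>p. D X Y p - D Y X p = lie_bracket A X Y p))"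

definition metric_connection ::
  "('m, 'n::finite) chart set \<Rightarrow> ('m \<Rightarrow> real ^ 'n \<Rightarrow> real ^ 'n \<Rightarrow> real) \<Rightarrow> ('m, 'n) connection \<Rightarrow> bool" where
  "metric_connection A g D \<longleftrightarrow>
     (\<forall>X Y Z. smooth_vector_field A X \<and> smooth_vector_field A Y \<and> smooth_vector_field A Z \<longrightarrow>
        (\<forall>p. vf_derivative A X (\<lambda>q. g q (Y q) (Z q)) p
               = g p (D X Y p) (Z p) + g p (Y p) (D X Z p)))"

definition levi_civita_connection ::
  "('m, 'n::finite) chart set \<Rightarrow> ('m \<Rightarrow> real ^ 'n \<Rightarrow> real ^ 'n \<Rightarrow> real) \<Rightarrow> ('m, 'n) connection \<Rightarrow> bool" where
  "levi_civita_connection A g D \<longleftrightarrow>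
     affine_connection A D \<and> torsion_free A D \<and> metric_connection A g D"

definition curvature ::
  "('m, 'n::finite) chart set \<Rightarrow> ('m, 'n) connection \<Rightarrow>
     ('m \<Rightarrow> real ^ 'n) \<Rightarrow> ('m \<Rightarrow> real ^ 'n) \<Rightarrow> ('m \<Rightarrow> real ^ 'n) \<Rightarrow> 'm \<Rightarrow> real ^ 'n" where
  "curvature A D X Y Z p = D X (D Y Z) p - D Y (D X Z) p - D (lie_bracket A X Y) Z p"

text \<open>
  \<open>ricci A D Y Z\<close> is the trace of \<open>X \<mapsto> R(X, Y)Z\<close>. This map is linear over the smooth functions, so
  \<open>(R(X, Y)Z)(p)\<close> depends on \<open>X\<close> only through \<open>X p\<close>, and the induced endomorphism of the
  tangent space at \<open>p\<close> can be computed with any smooth extension of a tangent vector.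
\<close>

definition vf_through :: "('m, 'n::finite) chart set \<Rightarrow> 'm \<Rightarrow> real ^ 'n \<Rightarrow> 'm \<Rightarrow> real ^ 'n" where
  "vf_through A p u = (SOME X. smooth_vector_field A X \<and> X p = u)"

definition ricci ::
  "('m, 'n::finite) chart set \<Rightarrow> ('m, 'n) connection \<Rightarrow>
     ('m \<Rightarrow> real ^ 'n) \<Rightarrow> ('m \<Rightarrow> real ^ 'n) \<Rightarrow> 'm \<Rightarrow> real" where
  "ricci A D Y Z p = trace (matrix (\<lambda>u. curvature A D (vf_through A p u) Y Z p))"

definition locally_ricci_symmetric ::
  "('m, 'n::finite) chart set \<Rightarrow> ('m, 'n) connection \<Rightarrow> bool" where
  "locally_ricci_symmetric A D \<longleftrightarrow>
     (\<forall>X Y Z. smooth_vector_field A X \<and> smooth_vector_field A Y \<and> smooth_vector_field A Z \<longrightarrow>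
        (\<forall>p. vf_derivative A X (ricci A D Y Z) p
               - ricci A D (D X Y) Z p - ricci A D Y (D X Z) p = 0))"

definition einstein ::
  "('m, 'n::finite) chart set \<Rightarrow> ('m \<Rightarrow> real ^ 'n \<Rightarrow> real ^ 'n \<Rightarrow> real) \<Rightarrow> ('m, 'n) connection \<Rightarrow> bool" where
  "einstein A g D \<longleftrightarrow>
     (\<exists>c::real. \<forall>Y Z. smooth_vector_field A Y \<and> smooth_vector_field A Z \<longrightarrow>
        (\<forall>p. ricci A D Y Z p = c * g p (Y p) (Z p)))"

definition almost_contact_metric_manifold ::
  "('m::{t2_space, second_countable_topology}, 'n::finite) chart set \<Rightarrow>
     ('m \<Rightarrow> real ^ 'n \<Rightarrow> real ^ 'n) \<Rightarrow> ('m \<Rightarrow> real ^ 'n) \<Rightarrow> ('m \<Rightarrow> real ^ 'n \<Rightarrow> real) \<Rightarrow>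
     ('m \<Rightarrow> real ^ 'n \<Rightarrow> real ^ 'n \<Rightarrow> real) \<Rightarrow> bool" where
  "almost_contact_metric_manifold A \<phi> \<xi> \<eta> g \<longleftrightarrow>
     (\<exists>n\<ge>1. CARD('n) = 2 * n + 1) \<and>
     smooth_atlas A \<and> connected (UNIV :: 'm set) \<and>
     endomorphism_field A \<phi> \<and> smooth_vector_field A \<xi> \<and> one_form A \<eta> \<and> riemannian_metric A g \<and>
     (\<forall>p u. \<phi> p (\<phi> p u) = - u + \<eta> p u *\<^sub>R \<xi> p) \<and>
     (\<forall>p. \<eta> p (\<xi> p) = 1) \<and>
     (\<forall>p u. \<eta> p (\<phi> p u) = 0) \<and>
     (\<forall>p. \<phi> p (\<xi> p) = 0) \<and>
     (\<forall>p u. \<eta> p u = g p u (\<xi> p)) \<and>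
     (\<forall>p u v. g p (\<phi> p u) (\<phi> p v) = g p u v - \<eta> p u * \<eta> p v)"

text \<open>
  In the third conjunct below, the left-hand side is \<open>(\<nabla>\<^sub>X \<phi>)(Y) = \<nabla>\<^sub>X (\<phi> Y) - \<phi> (\<nabla>\<^sub>X Y)\<close>.
\<close>

definition f_kenmotsu_manifold ::
  "('m::{t2_space, second_countable_topology}, 'n::finite) chart set \<Rightarrow>
     ('m \<Rightarrow> real ^ 'n \<Rightarrow> real ^ 'n) \<Rightarrow> ('m \<Rightarrow> real ^ 'n) \<Rightarrow> ('m \<Rightarrow> real ^ 'n \<Rightarrow> real) \<Rightarrow>
     ('m \<Rightarrow> real ^ 'n \<Rightarrow> real ^ 'n \<Rightarrow> real) \<Rightarrow> ('m, 'n) connection \<Rightarrow> ('m \<Rightarrow> real) \<Rightarrow> bool" where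
  "f_kenmotsu_manifold A \<phi> \<xi> \<eta> g D f \<longleftrightarrow>
     almost_contact_metric_manifold A \<phi> \<xi> \<eta> g \<and>
     levi_civita_connection A g D \<and>
     (\<forall>X Y. smooth_vector_field A X \<and> smooth_vector_field A Y \<longrightarrow>
        (\<forall>p. D X (\<lambda>q. \<phi> q (Y q)) p - \<phi> p (D X Y p)
               = f p *\<^sub>R (g p (\<phi> p (X p)) (Y p) *\<^sub>R \<xi> p - \<eta> p (Y p) *\<^sub>R \<phi> p (X p)))) \<and>
     smooth_function A f \<and> (\<forall>p. 0 < f p) \<and>
     (\<forall>p u v. wedge (differential A f) \<eta> p u v = 0)"

definition regular_f_kenmotsu_manifold ::
  "('m::{t2_space, second_countable_topology}, 'n::finite) chart set \<Rightarrow>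
     ('m \<Rightarrow> real ^ 'n \<Rightarrow> real ^ 'n) \<Rightarrow> ('m \<Rightarrow> real ^ 'n) \<Rightarrow> ('m \<Rightarrow> real ^ 'n \<Rightarrow> real) \<Rightarrow>
     ('m \<Rightarrow> real ^ 'n \<Rightarrow> real ^ 'n \<Rightarrow> real) \<Rightarrow> ('m, 'n) connection \<Rightarrow> ('m \<Rightarrow> real) \<Rightarrow> bool" where
  "regular_f_kenmotsu_manifold A \<phi> \<xi> \<eta> g D f \<longleftrightarrow>
     f_kenmotsu_manifold A \<phi> \<xi> \<eta> g D f \<and>
     (\<forall>p. (f p)\<^sup>2 + vf_derivative A \<xi> f p \<noteq> 0)"

end

theory Submission
  imports Defs "HOL-Real_Asymp.Real_Asymp"
begin

text \<open>
  The defining identity gives \<open>\<nabla>\<^sub>X \<xi> = f (X - \<eta>(X) \<xi>)\<close>, and since \<open>df = \<xi>(f) \<eta>\<close> one gets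
  \<open>R(X, Y) \<xi> = (f\<^sup>2 + \<xi>(f)) (\<eta>(X) Y - \<eta>(Y) X)\<close>, hence \<open>S(Y, \<xi>) = \<rho> \<eta>(Y)\<close> with
  \<open>\<rho> = - 2n (f\<^sup>2 + \<xi>(f))\<close>. Evaluating \<open>(\<nabla>\<^sub>X S)(Y, \<xi>) = 0\<close> yields
  \<open>X(\<rho>) \<eta>(Y) + f \<rho> g(X, Y) = f S(Y, X)\<close>. For \<open>X = Y = \<xi>\<close> this says \<open>\<xi>(\<rho>) = 0\<close>; as \<open>d(df) = 0\<close> and
  \<open>d\<eta> = 0\<close> force \<open>d\<rho> = \<xi>(\<rho>) \<eta>\<close>, the function \<open>\<rho>\<close> is constant and \<open>S = \<rho> g\<close>.
\<close>

text \<open>The analytic obstacle is that \<open>lie_bracket\<close> and \<open>vf_through\<close>,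
  and with them \<open>ricci\<close>, are descriptions over globally defined smooth vector fields.
  Nothing can be computed until the bracket is known to exist uniquely and every tangent vector to
  extend to a global smooth field. Uniqueness and extension come from bump functions, which cut
  local objects off inside one chart; existence comes from the coordinate formula for the bracket,
  hence from the symmetry of second derivatives. On the geometric side no calculus of forms is
  developed: closedness of \<eta> is the symmetry of g in the formula for X(\<eta>(Y)), and d(df) =
  0 is the defining property of the bracket [X, \<xi>] applied to f. The factor -2n is 1 - dim M,
  because the trace of u \<mapsto> \<eta>(u) Y - \<eta>(Y) u is (1 - dim M) \<eta>(Y).\<close>

subsection \<open>Frechet derivatives\<close>

lemma has_derivative_frechet_derivative:
  "f differentiable (at x) \<Longrightarrow> (f has_derivative frechet_derivative f (at x)) (at x)"
  using frechet_derivative_works by blast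

text \<open>Both functions have the same derivative maps at \<open>x\<close>, so the choice inside
  \<open>frechet_derivative\<close> returns the same map, also where no derivative exists.\<close>

lemma frechet_derivative_cong_open:
  assumes "open S" "x \<in> S" "\<And>y. y \<in> S \<Longrightarrow> f y = g y"
  shows "frechet_derivative f (at x) = frechet_derivative g (at x)"
    and "f differentiable (at x) \<longleftrightarrow> g differentiable (at x)"
proof -
  have "(f has_derivative f') (at x) \<longleftrightarrow> (g has_derivative f') (at x)" for f'
    using has_derivative_transform_within_open[OF _ assms(1,2), of f f' UNIV g]
      has_derivative_transform_within_open[OF _ assms(1,2), of g f' UNIV f] assms(3) by auto
  then show "frechet_derivative f (at x) = frechet_derivative g (at x)"
    and "f differentiable (at x) \<longleftrightarrow> g differentiable (at x)"
    by (simp_all add: frechet_derivative_def differentiable_def)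
qed

lemma frechet_derivative_add:
  "f differentiable (at x) \<Longrightarrow> g differentiable (at x) \<Longrightarrow>
    frechet_derivative (\<lambda>x. f x + g x) (at x) v
      = frechet_derivative f (at x) v + frechet_derivative g (at x) v"
  by (subst frechet_derivative_at[symmetric,
        OF has_derivative_add[OF has_derivative_frechet_derivative has_derivative_frechet_derivative]]) auto

lemma frechet_derivative_scaleR:
  fixes f :: "'a::real_normed_vector \<Rightarrow> real"
  assumes "f differentiable (at x)" "g differentiable (at x)"
  shows "frechet_derivative (\<lambda>x. f x *\<^sub>R g x) (at x) v
      = frechet_derivative f (at x) v *\<^sub>R g x + f x *\<^sub>R frechet_derivative g (at x) v"
  by (subst frechet_derivative_at[symmetric, OF has_derivative_scaleR[OF
        has_derivative_frechet_derivative[OF assms(1)] has_derivative_frechet_derivative[OF assms(2)]]])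
     simp

text \<open>Reduces a direction that varies with the point to finitely many fixed directions, the
  only ones that \<open>times_differentiable_on\<close> speaks about.\<close>

lemma frechet_derivative_basis_sum:
  fixes f :: "'a::euclidean_space \<Rightarrow> 'b::real_normed_vector"
  assumes "f differentiable (at x)"
  shows "frechet_derivative f (at x) v = (\<Sum>i\<in>Basis. (v \<bullet> i) *\<^sub>R frechet_derivative f (at x) i)"
proof -
  have "linear (frechet_derivative f (at x))"
    by (rule linear_frechet_derivative[OF assms])
  then show ?thesis
    by (subst euclidean_representation[of v, symmetric]) (simp add: linear_sum linear_scale)
qed


subsection \<open>Functions of class \<open>C\<^sup>k\<close>\<close>

lemma times_differentiable_on_cong_open:
  assumes "open S" "\<And>x. x \<in> S \<Longrightarrow> f x = g x" "times_differentiable_on k S f"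
  shows "times_differentiable_on k S g"
  using assms(2,3)
proof (induction k arbitrary: f g)
  case 0
  have "continuous_on S f \<longleftrightarrow> continuous_on S g"
    by (rule continuous_on_cong[OF refl 0(1)])
  with 0(2) show ?case by simp
next
  case (Suc k)
  note D = frechet_derivative_cong_open[of S _ f g, OF assms(1) _ Suc.prems(1)]
  have "times_differentiable_on k S (\<lambda>x. frechet_derivative g (at x) v)" for v
  proof (rule Suc.IH)
    show "frechet_derivative f (at x) v = frechet_derivative g (at x) v" if "x \<in> S" for x
      using D(1)[OF that] by simp
    show "times_differentiable_on k S (\<lambda>x. frechet_derivative f (at x) v)"
      using Suc.prems(2) by simp
  qed
  moreover have "g differentiable (at x)" if "x \<in> S" for x
    using D(2)[OF that] Suc.prems(2) that by simp
  ultimately show ?case by simp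
qed

text \<open>Lets the closure proofs below exhibit a derivative by the usual rules; uniqueness of
  derivatives identifies it with \<open>frechet_derivative\<close>.\<close>

lemma times_differentiable_on_SucI:
  assumes "open S" and f': "\<And>x. x \<in> S \<Longrightarrow> (f has_derivative f' x) (at x)"
    and k: "\<And>v. times_differentiable_on k S (\<lambda>x. f' x v)"
  shows "times_differentiable_on (Suc k) S f"
proof -
  have "times_differentiable_on k S (\<lambda>x. frechet_derivative f (at x) v)" for v
    by (rule times_differentiable_on_cong_open[OF assms(1) _ k]) (simp add: frechet_derivative_at[OF f', symmetric])
  moreover have "f differentiable (at x)" if "x \<in> S" for x
    using f'[OF that] by (rule differentiableI)
  ultimately show ?thesis by simp
qed

lemma times_differentiable_on_Suc_has_derivative:
  assumes "times_differentiable_on (Suc k) S f" "x \<in> S"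
  shows "(f has_derivative frechet_derivative f (at x)) (at x)"
  using assms by (intro has_derivative_frechet_derivative) simp

text \<open>Needed for the product and chain rules, whose derivatives still contain undifferentiated
  factors, to be treated one order lower.\<close>

lemma times_differentiable_on_SucD:
  assumes "times_differentiable_on (Suc k) S f"
  shows "times_differentiable_on k S f"
  using assms
proof (induction k arbitrary: f)
  case 0
  then show ?case
    by (auto intro!: continuous_at_imp_continuous_on differentiable_imp_continuous_within)
next
  case (Suc k)
  then show ?case by simp
qed

lemma times_differentiable_on_subset:
  assumes "times_differentiable_on k S f" "T \<subseteq> S"
  shows "times_differentiable_on k T f"
  using assms by (induction k arbitrary: f) (auto intro: continuous_on_subset)

lemma times_differentiable_on_Un:
  assumes "times_differentiable_on k S f" "times_differentiable_on k T f" "open S" "open T"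
  shows "times_differentiable_on k (S \<union> T) f"
  using assms by (induction k arbitrary: f) (auto intro: continuous_on_open_Un)

lemma times_differentiable_on_const: "times_differentiable_on k S (\<lambda>x. c)"
  by (induction k arbitrary: c) auto

lemma times_differentiable_on_add:
  assumes "open S" "times_differentiable_on k S f" "times_differentiable_on k S g"
  shows "times_differentiable_on k S (\<lambda>x. f x + g x)"
  using assms(2,3)
proof (induction k arbitrary: f g)
  case 0
  then show ?case by (auto intro: continuous_intros)
next
  case (Suc k)
  show ?case
  proof (rule times_differentiable_on_SucI[OF assms(1)])
    show "((\<lambda>x. f x + g x) has_derivative
        (\<lambda>v. frechet_derivative f (at x) v + frechet_derivative g (at x) v)) (at x)" if "x \<in> S" for x
      by (intro has_derivative_add times_differentiable_on_Suc_has_derivative[OF Suc.prems(1) that]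
          times_differentiable_on_Suc_has_derivative[OF Suc.prems(2) that])
    show "times_differentiable_on k S
        (\<lambda>x. frechet_derivative f (at x) v + frechet_derivative g (at x) v)" for v
      using Suc.prems by (intro Suc.IH) auto
  qed
qed

lemma times_differentiable_on_sum:
  assumes "open S" "\<And>i. i \<in> I \<Longrightarrow> times_differentiable_on k S (f i)"
  shows "times_differentiable_on k S (\<lambda>x. \<Sum>i\<in>I. f i x)"
  using assms(2)
  by (induction I rule: infinite_finite_induct)
     (auto intro: times_differentiable_on_const times_differentiable_on_add[OF assms(1)])

lemma times_differentiable_on_scaleR:
  fixes f :: "'a::real_normed_vector \<Rightarrow> real"
  assumes "open S" "times_differentiable_on k S f" "times_differentiable_on k S g"
  shows "times_differentiable_on k S (\<lambda>x. f x *\<^sub>R g x)"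
  using assms(2,3)
proof (induction k arbitrary: f g)
  case 0
  then show ?case by (auto intro: continuous_intros)
next
  case (Suc k)
  show ?case
  proof (rule times_differentiable_on_SucI[OF assms(1)])
    show "((\<lambda>x. f x *\<^sub>R g x) has_derivative
        (\<lambda>v. f x *\<^sub>R frechet_derivative g (at x) v + frechet_derivative f (at x) v *\<^sub>R g x)) (at x)"
      if "x \<in> S" for x
      by (intro has_derivative_scaleR times_differentiable_on_Suc_has_derivative[OF Suc.prems(1) that]
          times_differentiable_on_Suc_has_derivative[OF Suc.prems(2) that])
    show "times_differentiable_on k S
        (\<lambda>x. f x *\<^sub>R frechet_derivative g (at x) v + frechet_derivative f (at x) v *\<^sub>R g x)" for v
      using Suc.prems times_differentiable_on_SucD[OF Suc.prems(1)]
        times_differentiable_on_SucD[OF Suc.prems(2)]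
      by (intro times_differentiable_on_add Suc.IH assms(1)) auto
  qed
qed

lemma times_differentiable_on_bounded_linear:
  assumes "open S" "bounded_linear L" "times_differentiable_on k S f"
  shows "times_differentiable_on k S (\<lambda>x. L (f x))"
  using assms(3)
proof (induction k arbitrary: f)
  case 0
  then show ?case by (auto intro: bounded_linear.continuous_on[OF assms(2)])
next
  case (Suc k)
  show ?case
  proof (rule times_differentiable_on_SucI[OF assms(1)])
    show "((\<lambda>x. L (f x)) has_derivative (\<lambda>v. L (frechet_derivative f (at x) v))) (at x)"
      if "x \<in> S" for x
      by (intro bounded_linear.has_derivative[OF assms(2)]
          times_differentiable_on_Suc_has_derivative[OF Suc.prems that])
    show "times_differentiable_on k S (\<lambda>x. L (frechet_derivative f (at x) v))" for v
      using Suc.prems by (intro Suc.IH) auto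
  qed
qed

text \<open>The induction varies \<open>g\<close> and keeps \<open>f\<close>: by the chain rule in a
  basis, the derivative is a sum of products of components of the derivative of \<open>f\<close>
  with partial derivatives of \<open>g\<close>, again composed with \<open>f\<close>.\<close>

lemma times_differentiable_on_compose:
  fixes f :: "'a::real_normed_vector \<Rightarrow> 'b::euclidean_space"
    and g :: "'b \<Rightarrow> 'c::real_normed_vector"
  assumes "open S" "times_differentiable_on k T g" "times_differentiable_on k S f" "f ` S \<subseteq> T"
  shows "times_differentiable_on k S (\<lambda>x. g (f x))"
  using assms(2,3)
proof (induction k arbitrary: g)
  case 0
  then show ?case using assms(4) by (auto intro: continuous_on_compose2)
next
  case (Suc k)
  show ?case
  proof (rule times_differentiable_on_SucI[OF assms(1)])
    fix x assume x: "x \<in> S"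
    have g: "g differentiable (at (f x))"
      using Suc.prems(1) x assms(4) by auto
    have "((\<lambda>x. g (f x)) has_derivative
        (\<lambda>v. frechet_derivative g (at (f x)) (frechet_derivative f (at x) v))) (at x)"
      using diff_chain_at[OF times_differentiable_on_Suc_has_derivative[OF Suc.prems(2) x]
          has_derivative_frechet_derivative[OF g]] by (simp add: o_def)
    then show "((\<lambda>x. g (f x)) has_derivative (\<lambda>v. \<Sum>i\<in>Basis.
        (frechet_derivative f (at x) v \<bullet> i) *\<^sub>R frechet_derivative g (at (f x)) i)) (at x)"
      by (subst (asm) frechet_derivative_basis_sum[OF g])
  next
    show "times_differentiable_on k S (\<lambda>x. \<Sum>i\<in>Basis.
        (frechet_derivative f (at x) v \<bullet> i) *\<^sub>R frechet_derivative g (at (f x)) i)" for v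
      using Suc.prems times_differentiable_on_SucD[OF Suc.prems(2)]
      by (intro times_differentiable_on_sum times_differentiable_on_scaleR assms(1) Suc.IH
          times_differentiable_on_bounded_linear[OF assms(1) bounded_linear_inner_left]) auto
  qed
qed


subsection \<open>Smooth functions\<close>

lemma smooth_on_cong_open:
  "open S \<Longrightarrow> (\<And>x. x \<in> S \<Longrightarrow> f x = g x) \<Longrightarrow> smooth_on S f \<Longrightarrow> smooth_on S g"
  unfolding smooth_on_def using times_differentiable_on_cong_open by blast

lemma smooth_on_subset: "smooth_on S f \<Longrightarrow> T \<subseteq> S \<Longrightarrow> smooth_on T f"
  unfolding smooth_on_def using times_differentiable_on_subset by blast

lemma smooth_on_Un:
  "smooth_on S f \<Longrightarrow> smooth_on T f \<Longrightarrow> open S \<Longrightarrow> open T \<Longrightarrow> smooth_on (S \<union> T) f"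
  unfolding smooth_on_def using times_differentiable_on_Un by blast

lemma smooth_on_const: "smooth_on S (\<lambda>x. c)"
  unfolding smooth_on_def using times_differentiable_on_const by blast

lemma smooth_on_add:
  "open S \<Longrightarrow> smooth_on S f \<Longrightarrow> smooth_on S g \<Longrightarrow> smooth_on S (\<lambda>x. f x + g x)"
  unfolding smooth_on_def using times_differentiable_on_add by blast

lemma smooth_on_sum:
  "open S \<Longrightarrow> (\<And>i. i \<in> I \<Longrightarrow> smooth_on S (f i)) \<Longrightarrow> smooth_on S (\<lambda>x. \<Sum>i\<in>I. f i x)"
  unfolding smooth_on_def using times_differentiable_on_sum[of S I] by blast

lemma smooth_on_scaleR:
  fixes f :: "'a::real_normed_vector \<Rightarrow> real"
  shows "open S \<Longrightarrow> smooth_on S f \<Longrightarrow> smooth_on S g \<Longrightarrow> smooth_on S (\<lambda>x. f x *\<^sub>R g x)"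
  unfolding smooth_on_def using times_differentiable_on_scaleR by blast

lemma smooth_on_mult:
  fixes f g :: "'a::real_normed_vector \<Rightarrow> real"
  shows "open S \<Longrightarrow> smooth_on S f \<Longrightarrow> smooth_on S g \<Longrightarrow> smooth_on S (\<lambda>x. f x * g x)"
  using smooth_on_scaleR[of S f g] by simp

lemma smooth_on_bounded_linear:
  "open S \<Longrightarrow> bounded_linear L \<Longrightarrow> smooth_on S f \<Longrightarrow> smooth_on S (\<lambda>x. L (f x))"
  unfolding smooth_on_def using times_differentiable_on_bounded_linear by blast

lemma smooth_on_diff:
  fixes f :: "'a::real_normed_vector \<Rightarrow> 'b::real_normed_vector"
  assumes "open S" "smooth_on S f" "smooth_on S g"
  shows "smooth_on S (\<lambda>x. f x - g x)"
  using smooth_on_add[OF assms(1,2) smooth_on_scaleR[OF assms(1) smooth_on_const[of S "- 1"] assms(3)]]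
  by simp

lemma smooth_on_compose:
  fixes f :: "'a::real_normed_vector \<Rightarrow> 'b::euclidean_space"
  shows "open S \<Longrightarrow> smooth_on T g \<Longrightarrow> smooth_on S f \<Longrightarrow> f ` S \<subseteq> T \<Longrightarrow> smooth_on S (\<lambda>x. g (f x))"
  unfolding smooth_on_def using times_differentiable_on_compose by blast

lemma smooth_on_differentiable: "smooth_on S f \<Longrightarrow> x \<in> S \<Longrightarrow> f differentiable (at x)"
  unfolding smooth_on_def by (metis times_differentiable_on.simps(2))

lemma smooth_on_ident: "smooth_on S (\<lambda>x. x)"
  unfolding smooth_on_def
proof
  show "times_differentiable_on k S (\<lambda>x. x)" for k
    by (cases k) (auto intro: times_differentiable_on_const)
qed

lemma smooth_on_frechet_derivative_const:
  "smooth_on S f \<Longrightarrow> smooth_on S (\<lambda>x. frechet_derivative f (at x) v)"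
  unfolding smooth_on_def by (metis times_differentiable_on.simps(2))

lemma smooth_on_frechet_derivative:
  fixes f :: "'a::euclidean_space \<Rightarrow> 'b::real_normed_vector"
  assumes "open S" "smooth_on S f" "smooth_on S V"
  shows "smooth_on S (\<lambda>x. frechet_derivative f (at x) (V x))"
proof (rule smooth_on_cong_open[OF assms(1)])
  show "smooth_on S (\<lambda>x. \<Sum>i\<in>Basis. (V x \<bullet> i) *\<^sub>R frechet_derivative f (at x) i)"
    by (rule smooth_on_sum[OF assms(1)], rule smooth_on_scaleR[OF assms(1)
          smooth_on_bounded_linear[OF assms(1) bounded_linear_inner_left assms(3)]
          smooth_on_frechet_derivative_const[OF assms(2)]])
  show "(\<Sum>i\<in>Basis. (V x \<bullet> i) *\<^sub>R frechet_derivative f (at x) i) = frechet_derivative f (at x) (V x)"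
    if "x \<in> S" for x
    by (rule frechet_derivative_basis_sum[OF smooth_on_differentiable[OF assms(2) that], symmetric])
qed


subsection \<open>Symmetry of second derivatives\<close>

text \<open>Two mean value steps: along \<open>u\<close> for the difference between \<open>f\<close>
  shifted by \<open>h *\<^sub>R v\<close> and \<open>f\<close>, then along \<open>v\<close> for the
  resulting derivative in direction \<open>u\<close>. The second difference is symmetric in
  \<open>u\<close> and \<open>v\<close>, so it can be evaluated in either order.\<close>

lemma second_difference_mean_value:
  fixes f :: "'a::real_normed_vector \<Rightarrow> real"
  assumes "0 < h"
    and box: "\<And>s t. 0 \<le> s \<Longrightarrow> s \<le> h \<Longrightarrow> 0 \<le> t \<Longrightarrow> t \<le> h \<Longrightarrow> x + s *\<^sub>R u + t *\<^sub>R v \<in> S"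
    and f: "\<And>y. y \<in> S \<Longrightarrow> f differentiable (at y)"
    and f': "\<And>y. y \<in> S \<Longrightarrow> (\<lambda>z. frechet_derivative f (at z) u) differentiable (at y)"
  shows "\<exists>s t. 0 < s \<and> s < h \<and> 0 < t \<and> t < h \<and>
    f (x + h *\<^sub>R u + h *\<^sub>R v) - f (x + h *\<^sub>R u) - f (x + h *\<^sub>R v) + f x
      = h * h * frechet_derivative (\<lambda>z. frechet_derivative f (at z) u) (at (x + s *\<^sub>R u + t *\<^sub>R v)) v"
proof -
  have line: "((\<lambda>s. F (a + s *\<^sub>R w)) has_real_derivative frechet_derivative F (at (a + s *\<^sub>R w)) w) (at s)"
    if "F differentiable (at (a + s *\<^sub>R w))" for F :: "'a \<Rightarrow> real" and a w s
  proof -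
    have "((\<lambda>s. a + s *\<^sub>R w) has_derivative (\<lambda>r. r *\<^sub>R w)) (at s)"
      by (auto intro!: derivative_eq_intros)
    from has_derivative_compose[OF this has_derivative_frechet_derivative[OF that]]
    have "((\<lambda>s. F (a + s *\<^sub>R w)) has_derivative
        (\<lambda>r. frechet_derivative F (at (a + s *\<^sub>R w)) (r *\<^sub>R w))) (at s)" .
    moreover have "frechet_derivative F (at (a + s *\<^sub>R w)) (r *\<^sub>R w)
        = frechet_derivative F (at (a + s *\<^sub>R w)) w * r" for r
      using linear_scale[OF linear_frechet_derivative[OF that]] by simp
    ultimately show ?thesis by (simp add: has_field_derivative_def)
  qed
  define \<phi> where "\<phi> s = f ((x + h *\<^sub>R v) + s *\<^sub>R u) - f (x + s *\<^sub>R u)" for s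
  have "\<exists>s>0. s < h \<and> \<phi> h - \<phi> 0 = (h - 0) * (frechet_derivative f (at ((x + h *\<^sub>R v) + s *\<^sub>R u)) u
      - frechet_derivative f (at (x + s *\<^sub>R u)) u)"
    unfolding \<phi>_def
    using \<open>0 < h\<close> box[of _ h] box[of _ 0]
    by (intro MVT2 DERIV_diff line f) (auto simp: algebra_simps)
  then obtain s where s: "0 < s" "s < h"
    "\<phi> h - \<phi> 0 = h * (frechet_derivative f (at ((x + h *\<^sub>R v) + s *\<^sub>R u)) u
      - frechet_derivative f (at (x + s *\<^sub>R u)) u)" by auto
  define \<psi> where "\<psi> t = frechet_derivative f (at ((x + s *\<^sub>R u) + t *\<^sub>R v)) u" for t
  have "\<exists>t>0. t < h \<and> \<psi> h - \<psi> 0 = (h - 0) *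
      frechet_derivative (\<lambda>z. frechet_derivative f (at z) u) (at ((x + s *\<^sub>R u) + t *\<^sub>R v)) v"
    unfolding \<psi>_def
    using \<open>0 < h\<close> box[of s] s by (intro MVT2 line f') auto
  then obtain t where t: "0 < t" "t < h" "\<psi> h - \<psi> 0 = h *
      frechet_derivative (\<lambda>z. frechet_derivative f (at z) u) (at (x + s *\<^sub>R u + t *\<^sub>R v)) v" by auto
  have "\<phi> h - \<phi> 0 = h * (\<psi> h - \<psi> 0)"
    using s(3) by (simp add: \<psi>_def algebra_simps)
  then have "\<phi> h - \<phi> 0 = h * h *
      frechet_derivative (\<lambda>z. frechet_derivative f (at z) u) (at (x + s *\<^sub>R u + t *\<^sub>R v)) v"
    using t(3) by simp
  then show ?thesis
    using s(1,2) t(1,2) by (intro exI[of _ s] exI[of _ t]) (simp add: \<phi>_def algebra_simps)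
qed

text \<open>Evaluating one second difference in both orders gives a value of \<open>P\<close> equal
  to a value of \<open>Q\<close>, at two points near \<open>x\<close>. If \<open>P x\<close> and
  \<open>Q x\<close> differed, continuity would keep these values apart.\<close>

lemma frechet_derivative_commute:
  fixes f :: "'a::real_normed_vector \<Rightarrow> real"
  assumes "open S" "x \<in> S" "times_differentiable_on 2 S f"
  shows "frechet_derivative (\<lambda>z. frechet_derivative f (at z) u) (at x) v
    = frechet_derivative (\<lambda>z. frechet_derivative f (at z) v) (at x) u"
proof (rule ccontr)
  define P where "P y = frechet_derivative (\<lambda>z. frechet_derivative f (at z) u) (at y) v" for y
  define Q where "Q y = frechet_derivative (\<lambda>z. frechet_derivative f (at z) v) (at y) u" for y
  have f: "f differentiable (at y)"
    "(\<lambda>z. frechet_derivative f (at z) w) differentiable (at y)" if "y \<in> S" for y w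
    using assms(3) that by (auto simp: numeral_2_eq_2)
  have "continuous_on S P" "continuous_on S Q"
    using assms(3) unfolding P_def Q_def by (auto simp: numeral_2_eq_2)
  then have c: "isCont P x" "isCont Q x"
    using assms(1,2) continuous_on_eq_continuous_at by blast+
  assume "\<not> ?thesis"
  then have e: "\<bar>P x - Q x\<bar> / 2 > 0" by (simp add: P_def Q_def)
  obtain d1 where d1: "d1 > 0" "\<And>y. dist y x < d1 \<Longrightarrow> dist (P y) (P x) < \<bar>P x - Q x\<bar> / 2"
    using c(1) e unfolding continuous_at_eps_delta by blast
  obtain d2 where d2: "d2 > 0" "\<And>y. dist y x < d2 \<Longrightarrow> dist (Q y) (Q x) < \<bar>P x - Q x\<bar> / 2"
    using c(2) e unfolding continuous_at_eps_delta by blast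
  obtain d3 where d3: "d3 > 0" "ball x d3 \<subseteq> S"
    using assms(1,2) openE by blast
  define d where "d = min d1 (min d2 d3)"
  \<comment> \<open>The parallelogram with sides \<open>h *\<^sub>R u\<close> and
    \<open>h *\<^sub>R v\<close> then stays within \<open>d / 2\<close> of \<open>x\<close>; the
    summand 1 keeps the denominator positive if \<open>u\<close> and \<open>v\<close>
    vanish.\<close>
  define h where "h = d / (2 * (norm u + norm v + 1))"
  have pos: "norm u + norm v + 1 > 0" by (smt (verit) norm_ge_zero)
  have "d > 0" using d1 d2 d3 by (auto simp: d_def)
  then have "h > 0" using pos by (simp add: h_def)
  have near: "dist (x + s *\<^sub>R u + t *\<^sub>R v) x < d" if "0 \<le> s" "s \<le> h" "0 \<le> t" "t \<le> h" for s t
  proof -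
    have "dist (x + s *\<^sub>R u + t *\<^sub>R v) x = norm (s *\<^sub>R u + t *\<^sub>R v)"
      by (simp add: dist_norm algebra_simps)
    also have "\<dots> \<le> s * norm u + t * norm v"
      using norm_triangle_ineq[of "s *\<^sub>R u" "t *\<^sub>R v"] that by simp
    also have "\<dots> \<le> h * norm u + h * norm v"
      using that by (intro add_mono mult_right_mono) auto
    also have "\<dots> \<le> h * (norm u + norm v + 1)"
      using \<open>h > 0\<close> by (simp add: algebra_simps)
    also have "\<dots> = d / 2" using pos by (simp add: h_def field_simps)
    also have "\<dots> < d" using \<open>d > 0\<close> by simp
    finally show ?thesis .
  qed
  then have S: "x + s *\<^sub>R u + t *\<^sub>R v \<in> S" if "0 \<le> s" "s \<le> h" "0 \<le> t" "t \<le> h" for s t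
    using that d3 by (force simp: d_def dist_commute)
  obtain s t where st: "0 < s" "s < h" "0 < t" "t < h"
    "f (x + h *\<^sub>R u + h *\<^sub>R v) - f (x + h *\<^sub>R u) - f (x + h *\<^sub>R v) + f x
      = h * h * P (x + s *\<^sub>R u + t *\<^sub>R v)"
    using second_difference_mean_value[OF \<open>h > 0\<close> S f(1) f(2)] unfolding P_def by blast
  have S': "x + s *\<^sub>R v + t *\<^sub>R u \<in> S" if "0 \<le> s" "s \<le> h" "0 \<le> t" "t \<le> h" for s t
    using S[OF that(3,4,1,2)] by (simp add: algebra_simps)
  obtain s' t' where st': "0 < s'" "s' < h" "0 < t'" "t' < h"
    "f (x + h *\<^sub>R v + h *\<^sub>R u) - f (x + h *\<^sub>R v) - f (x + h *\<^sub>R u) + f x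
      = h * h * Q (x + s' *\<^sub>R v + t' *\<^sub>R u)"
    using second_difference_mean_value[OF \<open>h > 0\<close> S' f(1) f(2)] unfolding Q_def by blast
  have eqs: "x + h *\<^sub>R v + h *\<^sub>R u = x + h *\<^sub>R u + h *\<^sub>R v" "x + s' *\<^sub>R v + t' *\<^sub>R u = x + t' *\<^sub>R u + s' *\<^sub>R v"
    by (simp_all add: algebra_simps)
  have "h * h * P (x + s *\<^sub>R u + t *\<^sub>R v) = h * h * Q (x + t' *\<^sub>R u + s' *\<^sub>R v)"
    using st(5) st'(5)[unfolded eqs] by linarith
  then have "P (x + s *\<^sub>R u + t *\<^sub>R v) = Q (x + t' *\<^sub>R u + s' *\<^sub>R v)"
    using \<open>h > 0\<close> by simp
  moreover have "dist (P (x + s *\<^sub>R u + t *\<^sub>R v)) (P x) < \<bar>P x - Q x\<bar> / 2"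
    using near[of s t] st by (intro d1) (auto simp: d_def)
  moreover have "dist (Q (x + t' *\<^sub>R u + s' *\<^sub>R v)) (Q x) < \<bar>P x - Q x\<bar> / 2"
    using near[of t' s'] st' by (intro d2) (auto simp: d_def)
  ultimately have "\<bar>P (x + s *\<^sub>R u + t *\<^sub>R v) - P x\<bar> < \<bar>P x - Q x\<bar> / 2"
    "\<bar>P (x + s *\<^sub>R u + t *\<^sub>R v) - Q x\<bar> < \<bar>P x - Q x\<bar> / 2"
    by (simp_all add: dist_real_def)
  with abs_triangle_ineq4[of "P (x + s *\<^sub>R u + t *\<^sub>R v) - Q x" "P (x + s *\<^sub>R u + t *\<^sub>R v) - P x"]
  show False by simp
qed

subsection \<open>Bump functions\<close>

text \<open>For \<open>k = 0\<close> this is the standard flat function exp(-1/t). The powers of 1/t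
  make the family closed under differentiation up to linear combinations, so smoothness follows by
  induction on the order with \<open>k\<close> arbitrary.\<close>

definition flat_exp :: "nat \<Rightarrow> real \<Rightarrow> real" where
  "flat_exp k t = (if t > 0 then exp (- inverse t) * inverse t ^ k else 0)"

lemma flat_exp_has_derivative:
  "(flat_exp k has_real_derivative flat_exp (k + 2) t - real k * flat_exp (k + 1) t) (at t)"
proof -
  consider "t > 0" | "t < 0" | "t = 0" by linarith
  then show ?thesis
  proof cases
    case 1
    have "((\<lambda>t. exp (- inverse t) * inverse t ^ k) has_real_derivative
        flat_exp (k + 2) t - real k * flat_exp (k + 1) t) (at t)"
    proof -
      \<comment> \<open>The rule for powers produces the truncated exponent \<open>k - 1\<close>; at
        \<open>k = 0\<close> the factor \<open>real k\<close> removes that term, hence the case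
        split.\<close>
      have "flat_exp (k + 2) t - real k * flat_exp (k + 1) t
          = exp (- inverse t) * inverse (t\<^sup>2) * inverse t ^ k
          - exp (- inverse t) * (real k * (inverse t ^ (k - 1) * inverse (t\<^sup>2)))"
        using 1 by (cases k) (auto simp: flat_exp_def power2_eq_square algebra_simps)
      moreover have "((\<lambda>t. exp (- inverse t) * inverse t ^ k) has_real_derivative
          exp (- inverse t) * inverse (t\<^sup>2) * inverse t ^ k
          - exp (- inverse t) * (real k * (inverse t ^ (k - 1) * inverse (t\<^sup>2)))) (at t)"
        using 1 by (auto intro!: derivative_eq_intros simp: power2_eq_square)
      ultimately show ?thesis by (simp only:)
    qed
    then show ?thesis
      by (rule has_field_derivative_transform_within_open[of _ _ _ "{0<..}"])
         (use 1 in \<open>auto simp: flat_exp_def\<close>)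
  next
    case 2
    have "((\<lambda>t. 0) has_real_derivative flat_exp (k + 2) t - real k * flat_exp (k + 1) t) (at t)"
      using 2 by (simp add: flat_exp_def)
    then show ?thesis
      by (rule has_field_derivative_transform_within_open[of _ _ _ "{..<0}"])
         (use 2 in \<open>auto simp: flat_exp_def\<close>)
  next
    case 3
    \<comment> \<open>At 0 the right difference quotient is \<open>flat_exp (k + 1) h\<close>, which
      tends to 0 because the exponential beats every power of 1/h; the left one is identically
      0.\<close>
    have "((\<lambda>h. flat_exp k h / h) \<longlongrightarrow> 0) (at_right 0)"
    proof (rule Lim_transform_eventually)
      show "((\<lambda>h::real. exp (- inverse h) * inverse h ^ (k + 1)) \<longlongrightarrow> 0) (at_right 0)"
        by real_asymp
      show "\<forall>\<^sub>F h in at_right 0. exp (- inverse h) * inverse h ^ (k + 1) = flat_exp k h / h"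
        by (auto simp: eventually_at_filter flat_exp_def field_simps)
    qed
    moreover have "((\<lambda>h. flat_exp k h / h) \<longlongrightarrow> 0) (at_left 0)"
    proof (rule Lim_transform_eventually)
      show "\<forall>\<^sub>F h in at_left 0. 0 = flat_exp k h / h"
        by (auto simp: eventually_at_filter flat_exp_def)
    qed simp
    ultimately have "((\<lambda>h. flat_exp k h / h) \<longlongrightarrow> 0) (at 0)"
      by (simp add: filterlim_at_split)
    then show ?thesis
      using 3 by (simp add: DERIV_def flat_exp_def)
  qed
qed

lemma times_differentiable_on_flat_exp: "times_differentiable_on m UNIV (flat_exp k)"
proof (induction m arbitrary: k)
  case 0
  show ?case
    using DERIV_isCont[OF flat_exp_has_derivative] by (simp add: continuous_at_imp_continuous_on)
next
  case (Suc m)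
  show ?case
  proof (rule times_differentiable_on_SucI[OF open_UNIV])
    show "(flat_exp k has_derivative
        (\<lambda>v. v *\<^sub>R flat_exp (k + 2) t + (- v * real k) *\<^sub>R flat_exp (k + 1) t)) (at t)" for t
      using flat_exp_has_derivative[of k t]
      unfolding has_field_derivative_def by (rule has_derivative_eq_rhs) (auto simp: algebra_simps)
    show "times_differentiable_on m UNIV
        (\<lambda>t. v *\<^sub>R flat_exp (k + 2) t + (- v * real k) *\<^sub>R flat_exp (k + 1) t)" for v
      by (intro times_differentiable_on_add times_differentiable_on_scaleR
          times_differentiable_on_const open_UNIV Suc.IH)
  qed
qed

lemma smooth_bump_function:
  fixes a :: "'a::euclidean_space"
  assumes "open S" "a \<in> S"
  obtains \<psi> :: "'a \<Rightarrow> real" and r where "r > 0" "cball a r \<subseteq> S" "smooth_on UNIV \<psi>" "\<psi> a = 1"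
    "\<And>x. x \<notin> cball a r \<Longrightarrow> \<psi> x = 0"
proof -
  obtain r where r: "r > 0" "cball a r \<subseteq> S"
    using assms open_contains_cball by blast
  \<comment> \<open>This is r^2 - |x - a|^2, positive exactly on the open ball. The squared norm is
    spelled out in coordinates so that the closure rules for sums and products give
    smoothness.\<close>
  define q where "q x = r\<^sup>2 + (- 1) *\<^sub>R (\<Sum>i\<in>Basis. ((x - a) \<bullet> i) *\<^sub>R ((x - a) \<bullet> i))" for x :: 'a
  have "(dist a x)\<^sup>2 = (x - a) \<bullet> (x - a)" for x
    by (metis dist_commute dist_norm power2_norm_eq_inner)
  then have q: "q x = r\<^sup>2 - (dist a x)\<^sup>2" for x
    by (simp add: q_def euclidean_inner[of "x - a" "x - a"])
  have "smooth_on UNIV (\<lambda>x. (x - a) \<bullet> i)" for i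
    by (rule smooth_on_bounded_linear[OF open_UNIV bounded_linear_inner_left
          smooth_on_diff[OF open_UNIV smooth_on_ident smooth_on_const]])
  then have "smooth_on UNIV q"
    unfolding q_def
    by (intro smooth_on_add[OF open_UNIV smooth_on_const] smooth_on_scaleR[OF open_UNIV smooth_on_const]
        smooth_on_sum[OF open_UNIV] smooth_on_scaleR[OF open_UNIV])
  then have fq: "smooth_on UNIV (\<lambda>x. flat_exp 0 (q x))"
    using smooth_on_compose[OF open_UNIV _ \<open>smooth_on UNIV q\<close>, of UNIV "flat_exp 0"]
      times_differentiable_on_flat_exp by (simp add: smooth_on_def)
  \<comment> \<open>Since \<open>q a\<close> is the square of \<open>r\<close>, the constant factor
    normalises the value at \<open>a\<close> to 1.\<close>
  define \<psi> where "\<psi> x = inverse (flat_exp 0 (r\<^sup>2)) *\<^sub>R flat_exp 0 (q x)" for x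
  show thesis
  proof (rule that[OF r])
    show "smooth_on UNIV \<psi>"
      unfolding \<psi>_def by (rule smooth_on_scaleR[OF open_UNIV smooth_on_const fq])
    show "\<psi> a = 1"
      using r(1) by (simp add: \<psi>_def q flat_exp_def)
    show "\<psi> x = 0" if "x \<notin> cball a r" for x
    proof -
      have "r\<^sup>2 < (dist a x)\<^sup>2"
        using that r(1) by (intro power_strict_mono) auto
      then show ?thesis by (simp add: \<psi>_def q flat_exp_def)
    qed
  qed
qed


subsection \<open>Commutators of directional derivatives\<close>

text \<open>Product rule for the basis expansion of the derivative of \<open>h\<close> along
  \<open>W\<close>: one second-order term with \<open>W\<close> held at \<open>x\<close>, one
  first-order term in which \<open>W\<close> is differentiated.\<close>

lemma has_derivative_frechet_derivative_along:
  fixes h :: "'a::euclidean_space \<Rightarrow> 'b::real_normed_vector"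
  assumes "open S" "x \<in> S" "smooth_on S h" "smooth_on S W"
  shows "((\<lambda>y. frechet_derivative h (at y) (W y)) has_derivative
    (\<lambda>u. (\<Sum>i\<in>Basis. (W x \<bullet> i) *\<^sub>R frechet_derivative (\<lambda>y. frechet_derivative h (at y) i) (at x) u)
      + frechet_derivative h (at x) (frechet_derivative W (at x) u))) (at x)"
proof -
  note h = smooth_on_differentiable[OF assms(3)]
  have W: "((\<lambda>y. W y \<bullet> i) has_derivative (\<lambda>u. frechet_derivative W (at x) u \<bullet> i)) (at x)" for i
    by (rule bounded_linear.has_derivative[OF bounded_linear_inner_left
          has_derivative_frechet_derivative[OF smooth_on_differentiable[OF assms(4,2)]]])
  have Dh: "((\<lambda>y. frechet_derivative h (at y) i) has_derivative
      frechet_derivative (\<lambda>y. frechet_derivative h (at y) i) (at x)) (at x)" for i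
    by (rule has_derivative_frechet_derivative[OF smooth_on_differentiable[OF
            smooth_on_frechet_derivative_const[OF assms(3)] assms(2)]])
  have "((\<lambda>y. \<Sum>i\<in>Basis. (W y \<bullet> i) *\<^sub>R frechet_derivative h (at y) i) has_derivative
      (\<lambda>u. \<Sum>i\<in>Basis. (W x \<bullet> i) *\<^sub>R frechet_derivative (\<lambda>y. frechet_derivative h (at y) i) (at x) u
        + (frechet_derivative W (at x) u \<bullet> i) *\<^sub>R frechet_derivative h (at x) i)) (at x)"
    by (rule has_derivative_sum) (rule has_derivative_scaleR[OF W Dh])
  then have "((\<lambda>y. \<Sum>i\<in>Basis. (W y \<bullet> i) *\<^sub>R frechet_derivative h (at y) i) has_derivative
      (\<lambda>u. (\<Sum>i\<in>Basis. (W x \<bullet> i) *\<^sub>R frechet_derivative (\<lambda>y. frechet_derivative h (at y) i) (at x) u)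
        + frechet_derivative h (at x) (frechet_derivative W (at x) u))) (at x)"
    unfolding sum.distrib frechet_derivative_basis_sum[OF h[OF assms(2)], symmetric] .
  then show ?thesis
    by (rule has_derivative_transform_within_open[OF _ assms(1,2)])
       (simp only: frechet_derivative_basis_sum[OF h, symmetric])
qed

lemma frechet_derivative_along:
  fixes h :: "'a::euclidean_space \<Rightarrow> 'b::real_normed_vector"
  assumes "open S" "x \<in> S" "smooth_on S h" "smooth_on S W"
  shows "frechet_derivative (\<lambda>y. frechet_derivative h (at y) (W y)) (at x) u
    = frechet_derivative (\<lambda>y. frechet_derivative h (at y) (W x)) (at x) u
      + frechet_derivative h (at x) (frechet_derivative W (at x) u)"
proof -
  have "linear (frechet_derivative h (at x))"
    by (rule linear_frechet_derivative[OF smooth_on_differentiable[OF assms(3,2)]])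
  then show ?thesis
    \<comment> \<open>The formula is used for \<open>W\<close> and for the constant field with value
      \<open>W x\<close>. The second use has no first-order term and so identifies the second-order
      sum of the first.\<close>
    using fun_cong[OF frechet_derivative_at[OF
          has_derivative_frechet_derivative_along[OF assms(1-3) assms(4)]], of u]
      fun_cong[OF frechet_derivative_at[OF
          has_derivative_frechet_derivative_along[OF assms(1-3) smooth_on_const[of S "W x"]]], of u]
    by (simp add: linear_0)
qed

text \<open>The second-order terms cancel by symmetry of second derivatives. What remains is
  \<open>h\<close> differentiated along the coordinate bracket of \<open>V\<close> and
  \<open>W\<close>.\<close>

lemma frechet_derivative_commutator:
  fixes h :: "'a::euclidean_space \<Rightarrow> real"
  assumes "open S" "x \<in> S" "smooth_on S h" "smooth_on S V" "smooth_on S W"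
  shows "frechet_derivative (\<lambda>y. frechet_derivative h (at y) (W y)) (at x) (V x)
      - frechet_derivative (\<lambda>y. frechet_derivative h (at y) (V y)) (at x) (W x)
    = frechet_derivative h (at x)
        (frechet_derivative W (at x) (V x) - frechet_derivative V (at x) (W x))"
proof -
  have "linear (frechet_derivative h (at x))"
    by (rule linear_frechet_derivative[OF smooth_on_differentiable[OF assms(3,2)]])
  moreover have "frechet_derivative (\<lambda>y. frechet_derivative h (at y) (W x)) (at x) (V x)
      = frechet_derivative (\<lambda>y. frechet_derivative h (at y) (V x)) (at x) (W x)"
    using assms(3) by (intro frechet_derivative_commute[OF assms(1,2)]) (simp add: smooth_on_def)
  ultimately show ?thesis
    unfolding frechet_derivative_along[OF assms(1-3) assms(4)]
      frechet_derivative_along[OF assms(1-3) assms(5)]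
    by (simp add: linear_diff)
qed


subsection \<open>Charts\<close>

locale smooth_manifold =
  fixes A :: "('m::{t2_space, second_countable_topology}, 'n::finite) chart set"
  assumes atlas: "smooth_atlas A"
begin

lemma chart_at: "chart_at A p \<in> A" "p \<in> fst (chart_at A p)"
proof -
  have "\<exists>c. c \<in> A \<and> p \<in> fst c"
    using atlas UNIV_I[of p] unfolding smooth_atlas_def by blast
  then have "chart_at A p \<in> A \<and> p \<in> fst (chart_at A p)"
    unfolding chart_at_def by (rule someI_ex)
  then show "chart_at A p \<in> A" "p \<in> fst (chart_at A p)" by auto
qed

lemma
  assumes "c \<in> A"
  shows open_chart_domain: "open (fst c)"
    and open_chart_image: "open (chart_image c)"
    and chart_homeomorphism: "homeomorphism (fst c) (chart_image c) (snd c) (chart_inv c)"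
  using atlas assms unfolding smooth_atlas_def is_chart_def by auto

lemma chart_inv_chart: "c \<in> A \<Longrightarrow> p \<in> fst c \<Longrightarrow> chart_inv c (snd c p) = p"
  using chart_homeomorphism[of c] unfolding homeomorphism_def by blast

lemma chart_chart_inv: "x \<in> chart_image c \<Longrightarrow> snd c (chart_inv c x) = x"
  by (rule f_inv_into_f)

lemma chart_inv_in_domain: "x \<in> chart_image c \<Longrightarrow> chart_inv c x \<in> fst c"
  by (rule inv_into_into)

lemma open_chart_image_of:
  assumes "c \<in> A" "open U"
  shows "open (snd c ` (fst c \<inter> U))"
proof -
  have "snd c ` (fst c \<inter> U) = chart_image c \<inter> chart_inv c -` U"
    using chart_inv_chart[OF assms(1)] by force
  moreover have "continuous_on (chart_image c) (chart_inv c)"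
    using chart_homeomorphism[OF assms(1)] by (simp add: homeomorphism_def)
  ultimately show ?thesis
    using continuous_open_preimage[OF _ open_chart_image[OF assms(1)] assms(2)] by simp
qed

lemma smooth_on_transition:
  "c \<in> A \<Longrightarrow> c' \<in> A \<Longrightarrow> smooth_on (snd c ` (fst c \<inter> fst c')) (snd c' \<circ> chart_inv c)"
  using atlas unfolding smooth_atlas_def by blast

lemma transition_differentiable:
  assumes "c \<in> A" "c' \<in> A" "p \<in> fst c" "p \<in> fst c'"
  shows "(snd c' \<circ> chart_inv c) differentiable (at (snd c p))"
  using smooth_on_differentiable[OF smooth_on_transition[OF assms(1,2)]] assms(3,4) by blast

text \<open>Chain rule through the transition map on the overlap of the charts. As \<open>h\<close>
  may be vector valued, taking it to be a chart map also gives the cocycle rule for tangent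
  components.\<close>

lemma frechet_derivative_change_chart:
  assumes "c \<in> A" "c' \<in> A" "p \<in> fst c" "p \<in> fst c'"
    and h: "(h \<circ> chart_inv c') differentiable (at (snd c' p))"
  shows "frechet_derivative (h \<circ> chart_inv c) (at (snd c p)) v
    = frechet_derivative (h \<circ> chart_inv c') (at (snd c' p))
        (frechet_derivative (snd c' \<circ> chart_inv c) (at (snd c p)) v)"
proof -
  let ?S = "snd c ` (fst c \<inter> fst c')"
  have "(h \<circ> chart_inv c) y = ((h \<circ> chart_inv c') \<circ> (snd c' \<circ> chart_inv c)) y" if "y \<in> ?S" for y
    using that chart_inv_chart assms(1,2) by auto
  then have "frechet_derivative (h \<circ> chart_inv c) (at (snd c p))
      = frechet_derivative ((h \<circ> chart_inv c') \<circ> (snd c' \<circ> chart_inv c)) (at (snd c p))"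
    using assms(3,4) open_chart_image_of[OF assms(1) open_chart_domain[OF assms(2)]]
    by (intro frechet_derivative_cong_open(1)[of ?S]) auto
  also have "\<dots> = frechet_derivative (h \<circ> chart_inv c') (at ((snd c' \<circ> chart_inv c) (snd c p)))
      \<circ> frechet_derivative (snd c' \<circ> chart_inv c) (at (snd c p))"
    using transition_differentiable[OF assms(1-4)] h chart_inv_chart[OF assms(1,3)]
    by (intro frechet_derivative_compose) simp_all
  finally show ?thesis
    using chart_inv_chart[OF assms(1,3)] by simp
qed

lemma linear_tangent_comp: "c \<in> A \<Longrightarrow> p \<in> fst c \<Longrightarrow> linear (tangent_comp A c p)"
  unfolding tangent_comp_def
  by (intro linear_frechet_derivative transition_differentiable chart_at)

lemma frechet_derivative_chart_self:
  assumes "c \<in> A" "p \<in> fst c"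
  shows "frechet_derivative (snd c \<circ> chart_inv c) (at (snd c p)) v = v"
proof -
  have "frechet_derivative (snd c \<circ> chart_inv c) (at (snd c p))
      = frechet_derivative (\<lambda>x. x) (at (snd c p))"
    by (intro frechet_derivative_cong_open(1)[OF open_chart_image[OF assms(1)]])
      (auto simp: chart_inv_chart[OF assms(1)] assms(2))
  then show ?thesis by simp
qed

lemma tangent_comp_chart_at: "tangent_comp A (chart_at A p) p v = v"
  by (simp add: tangent_comp_def frechet_derivative_chart_self chart_at)

text \<open>The argument of \<open>tangent_comp\<close> is the tangent vector whose components in
  \<open>c\<close> are \<open>v\<close>. With \<open>c' = c\<close> this shows that every
  \<open>v\<close> occurs as the components of a tangent vector.\<close>

lemma tangent_comp_of_chart_at:
  assumes "c \<in> A" "c' \<in> A" "p \<in> fst c" "p \<in> fst c'"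
  shows "tangent_comp A c' p (frechet_derivative (snd (chart_at A p) \<circ> chart_inv c) (at (snd c p)) v)
    = frechet_derivative (snd c' \<circ> chart_inv c) (at (snd c p)) v"
  unfolding tangent_comp_def
  by (rule frechet_derivative_change_chart[OF assms(1) chart_at(1) assms(3) chart_at(2),
        OF transition_differentiable[OF chart_at(1) assms(2) chart_at(2) assms(4)], symmetric])

lemma differential_in_chart:
  assumes "c \<in> A" "p \<in> fst c" "(h \<circ> chart_inv c) differentiable (at (snd c p))"
  shows "differential A h p v
    = frechet_derivative (h \<circ> chart_inv c) (at (snd c p)) (tangent_comp A c p v)"
  unfolding differential_def tangent_comp_def
  by (rule frechet_derivative_change_chart[OF chart_at(1) assms(1) chart_at(2) assms(2,3)])


subsection \<open>Smooth functions and vector fields\<close>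

lemma smooth_function_differentiable:
  assumes "smooth_function A h" "c \<in> A" "p \<in> fst c"
  shows "(h \<circ> chart_inv c) differentiable (at (snd c p))"
  using assms unfolding smooth_function_def by (intro smooth_on_differentiable[of "chart_image c"]) auto

lemma smooth_function_const: "smooth_function A (\<lambda>p. k)"
  by (auto simp: smooth_function_def o_def intro: smooth_on_const)

lemma smooth_function_add:
  "smooth_function A h \<Longrightarrow> smooth_function A k \<Longrightarrow> smooth_function A (\<lambda>p. h p + k p)"
  unfolding smooth_function_def o_def by (auto intro: smooth_on_add open_chart_image)

lemma smooth_function_mult:
  "smooth_function A h \<Longrightarrow> smooth_function A k \<Longrightarrow> smooth_function A (\<lambda>p. h p * k p)"
  unfolding smooth_function_def o_def by (auto intro: smooth_on_mult open_chart_image)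

lemma smooth_vector_field_add:
  assumes "smooth_vector_field A X" "smooth_vector_field A Y"
  shows "smooth_vector_field A (\<lambda>p. X p + Y p)"
  unfolding smooth_vector_field_def
proof
  fix c assume c: "c \<in> A"
  have "smooth_on (chart_image c) (\<lambda>x. ((\<lambda>p. tangent_comp A c p (X p)) \<circ> chart_inv c) x
      + ((\<lambda>p. tangent_comp A c p (Y p)) \<circ> chart_inv c) x)"
    using assms c unfolding smooth_vector_field_def
    by (intro smooth_on_add open_chart_image) (auto simp: o_def)
  then show "smooth_on (chart_image c) ((\<lambda>p. tangent_comp A c p (X p + Y p)) \<circ> chart_inv c)"
    by (rule smooth_on_cong_open[OF open_chart_image[OF c], rotated])
       (simp add: linear_add[OF linear_tangent_comp[OF c chart_inv_in_domain]])
qed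

lemma smooth_vector_field_scaleR:
  assumes "smooth_function A h" "smooth_vector_field A X"
  shows "smooth_vector_field A (\<lambda>p. h p *\<^sub>R X p)"
  unfolding smooth_vector_field_def
proof
  fix c assume c: "c \<in> A"
  have "smooth_on (chart_image c) (\<lambda>x. (h \<circ> chart_inv c) x
      *\<^sub>R ((\<lambda>p. tangent_comp A c p (X p)) \<circ> chart_inv c) x)"
    using assms c unfolding smooth_vector_field_def smooth_function_def
    by (intro smooth_on_scaleR open_chart_image) (auto simp: o_def)
  then show "smooth_on (chart_image c) ((\<lambda>p. tangent_comp A c p (h p *\<^sub>R X p)) \<circ> chart_inv c)"
    by (rule smooth_on_cong_open[OF open_chart_image[OF c], rotated])
       (simp add: linear_scale[OF linear_tangent_comp[OF c chart_inv_in_domain]])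
qed

lemma smooth_vector_field_diff:
  assumes "smooth_vector_field A X" "smooth_vector_field A Y"
  shows "smooth_vector_field A (\<lambda>p. X p - Y p)"
  using smooth_vector_field_add[OF assms(1)
      smooth_vector_field_scaleR[OF smooth_function_const[of "- 1"] assms(2)]] by simp

lemma differential_const: "differential A (\<lambda>p. k) p v = 0"
  by (simp add: differential_def o_def)

lemma differential_add:
  assumes "smooth_function A h" "smooth_function A k"
  shows "differential A (\<lambda>p. h p + k p) p v = differential A h p v + differential A k p v"
  using frechet_derivative_add[OF smooth_function_differentiable[OF assms(1) chart_at]
      smooth_function_differentiable[OF assms(2) chart_at]]
  by (simp add: differential_def o_def)

lemma differential_mult:
  assumes "smooth_function A h" "smooth_function A k"
  shows "differential A (\<lambda>p. h p * k p) p v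
    = differential A h p v * k p + h p * differential A k p v"
  using frechet_derivative_scaleR[OF smooth_function_differentiable[OF assms(1) chart_at]
      smooth_function_differentiable[OF assms(2) chart_at]]
  by (simp add: differential_def o_def chart_inv_chart[OF chart_at])

definition local_rep :: "('m, 'n) chart \<Rightarrow> ('m \<Rightarrow> real ^ 'n) \<Rightarrow> real ^ 'n \<Rightarrow> real ^ 'n" where
  "local_rep c X = (\<lambda>p. tangent_comp A c p (X p)) \<circ> chart_inv c"

lemma smooth_on_local_rep:
  "smooth_vector_field A X \<Longrightarrow> c \<in> A \<Longrightarrow> smooth_on (chart_image c) (local_rep c X)"
  unfolding smooth_vector_field_def local_rep_def by blast

lemma vf_derivative_in_chart:
  assumes "smooth_function A h" "c \<in> A" "x \<in> chart_image c"
  shows "(vf_derivative A X h \<circ> chart_inv c) x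
    = frechet_derivative (h \<circ> chart_inv c) (at x) (local_rep c X x)"
  using differential_in_chart[OF assms(2) chart_inv_in_domain[OF assms(3)]
      smooth_function_differentiable[OF assms(1,2) chart_inv_in_domain[OF assms(3)]]]
  by (simp add: vf_derivative_def local_rep_def chart_chart_inv[OF assms(3)])

lemma smooth_function_vf_derivative:
  assumes "smooth_function A h" "smooth_vector_field A X"
  shows "smooth_function A (vf_derivative A X h)"
  unfolding smooth_function_def
proof
  fix c assume c: "c \<in> A"
  have "smooth_on (chart_image c) (\<lambda>x. frechet_derivative (h \<circ> chart_inv c) (at x) (local_rep c X x))"
    using assms c by (intro smooth_on_frechet_derivative open_chart_image smooth_on_local_rep)
      (auto simp: smooth_function_def)
  then show "smooth_on (chart_image c) (vf_derivative A X h \<circ> chart_inv c)"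
    by (rule smooth_on_cong_open[OF open_chart_image[OF c], rotated])
       (simp add: vf_derivative_in_chart[OF assms(1) c] del: o_apply)
qed

end

subsection \<open>Extension by zero from a chart\<close>

context smooth_manifold
begin

text \<open>The domain of \<open>c\<close> is covered by the overlap with \<open>c0\<close> and the
  complement of the support \<open>K\<close>. \<open>K\<close> is compact, hence closed in a
  Hausdorff space, so both pieces are open, and \<open>F\<close> vanishes on the second.\<close>

lemma smooth_on_extension_by_zero:
  assumes "c \<in> A" "c0 \<in> A" "cball a r \<subseteq> chart_image c0"
    and F: "smooth_on (snd c ` (fst c \<inter> fst c0)) F"
    and zero: "\<And>p. p \<in> fst c \<Longrightarrow> p \<notin> chart_inv c0 ` cball a r \<Longrightarrow> F (snd c p) = 0"
  shows "smooth_on (chart_image c) F"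
proof -
  define K where "K = chart_inv c0 ` cball a r"
  have "continuous_on (cball a r) (chart_inv c0)"
    by (rule continuous_on_subset[OF homeomorphism_cont2[OF chart_homeomorphism[OF assms(2)]] assms(3)])
  then have "closed K"
    unfolding K_def by (intro compact_imp_closed compact_continuous_image compact_cball)
  then have oK: "open (snd c ` (fst c \<inter> - K))"
    by (intro open_chart_image_of[OF assms(1)]) auto
  have "smooth_on (snd c ` (fst c \<inter> - K)) F"
    by (rule smooth_on_cong_open[OF oK _ smooth_on_const[of _ 0]]) (use zero in \<open>force simp: K_def\<close>)
  then have "smooth_on (snd c ` (fst c \<inter> fst c0) \<union> snd c ` (fst c \<inter> - K)) F"
    by (rule smooth_on_Un[OF F _ open_chart_image_of[OF assms(1) open_chart_domain[OF assms(2)]] oK])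
  moreover have "K \<subseteq> fst c0"
    unfolding K_def by (intro image_subsetI chart_inv_in_domain) (rule subsetD[OF assms(3)])
  then have "chart_image c \<subseteq> snd c ` (fst c \<inter> fst c0) \<union> snd c ` (fst c \<inter> - K)" by auto
  ultimately show ?thesis
    by (rule smooth_on_subset)
qed

lemma not_in_compact_support:
  assumes "c \<in> A" "p \<in> fst c" "p \<notin> chart_inv c ` cball a r"
  shows "snd c p \<notin> cball a r"
  using assms chart_inv_chart[OF assms(1,2)] by (metis imageI)

lemma smooth_function_extension_by_zero:
  assumes "c0 \<in> A" "cball a r \<subseteq> chart_image c0" "smooth_on UNIV F"
    "\<And>x. x \<notin> cball a r \<Longrightarrow> F x = 0"
  shows "smooth_function A (\<lambda>p. if p \<in> fst c0 then F (snd c0 p) else 0)"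
  unfolding smooth_function_def
proof
  fix c assume c: "c \<in> A"
  let ?S = "snd c ` (fst c \<inter> fst c0)"
  have S: "open ?S" by (intro open_chart_image_of c open_chart_domain assms(1))
  have "smooth_on ?S (\<lambda>x. F ((snd c0 \<circ> chart_inv c) x))"
    by (rule smooth_on_compose[OF S assms(3) smooth_on_transition[OF c assms(1)]]) simp
  then have "smooth_on ?S ((\<lambda>p. if p \<in> fst c0 then F (snd c0 p) else 0) \<circ> chart_inv c)"
    by (rule smooth_on_cong_open[OF S, rotated]) (auto simp: chart_inv_chart[OF c])
  then show "smooth_on (chart_image c) ((\<lambda>p. if p \<in> fst c0 then F (snd c0 p) else 0) \<circ> chart_inv c)"
  proof (rule smooth_on_extension_by_zero[OF c assms(1,2)])
    fix p assume "p \<in> fst c" "p \<notin> chart_inv c0 ` cball a r"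
    then show "((\<lambda>p. if p \<in> fst c0 then F (snd c0 p) else 0) \<circ> chart_inv c) (snd c p) = 0"
      using not_in_compact_support[OF assms(1)] assms(4) by (simp add: chart_inv_chart[OF c])
  qed
qed

text \<open>In \<open>c0\<close> this is the constant field \<open>w\<close> times the cutoff. The
  derivative of the transition map converts its components to the chart chosen at each point, in
  which tangent vectors are represented.\<close>

lemma smooth_vector_field_extension_by_zero:
  assumes "c0 \<in> A" "cball a r \<subseteq> chart_image c0" "smooth_on UNIV \<psi>"
    "\<And>x. x \<notin> cball a r \<Longrightarrow> \<psi> x = 0"
  shows "smooth_vector_field A (\<lambda>p. if p \<in> fst c0 then
    \<psi> (snd c0 p) *\<^sub>R frechet_derivative (snd (chart_at A p) \<circ> chart_inv c0) (at (snd c0 p)) w else 0)"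
    (is "smooth_vector_field A ?X")
  unfolding smooth_vector_field_def
proof
  fix c assume c: "c \<in> A"
  let ?S = "snd c ` (fst c \<inter> fst c0)"
  let ?T = "snd c0 ` (fst c0 \<inter> fst c)"
  let ?t = "snd c0 \<circ> chart_inv c"
  have S: "open ?S" by (intro open_chart_image_of c open_chart_domain assms(1))
  note t = smooth_on_transition[OF c assms(1)]
  have "smooth_on ?S (\<lambda>x. \<psi> (?t x))"
    by (rule smooth_on_compose[OF S assms(3) t]) simp
  moreover have "smooth_on ?S (\<lambda>x. frechet_derivative (snd c \<circ> chart_inv c0) (at (?t x)) w)"
    by (rule smooth_on_compose[OF S smooth_on_frechet_derivative_const[OF
            smooth_on_transition[OF assms(1) c]] t]) (auto simp: chart_inv_chart[OF c])
  ultimately have "smooth_on ?S (\<lambda>x. \<psi> (?t x) *\<^sub>R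
      frechet_derivative (snd c \<circ> chart_inv c0) (at (?t x)) w)"
    by (rule smooth_on_scaleR[OF S])
  moreover have "\<psi> (?t x) *\<^sub>R frechet_derivative (snd c \<circ> chart_inv c0) (at (?t x)) w
      = ((\<lambda>p. tangent_comp A c p (?X p)) \<circ> chart_inv c) x" if "x \<in> ?S" for x
  proof -
    obtain p where p: "p \<in> fst c" "p \<in> fst c0" "x = snd c p" using \<open>x \<in> ?S\<close> by blast
    then show ?thesis
      by (simp add: chart_inv_chart[OF c] linear_scale[OF linear_tangent_comp[OF c]]
          tangent_comp_of_chart_at[OF assms(1) c])
  qed
  ultimately have "smooth_on ?S ((\<lambda>p. tangent_comp A c p (?X p)) \<circ> chart_inv c)"
    by (rule smooth_on_cong_open[OF S, rotated])
  then show "smooth_on (chart_image c) ((\<lambda>p. tangent_comp A c p (?X p)) \<circ> chart_inv c)"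
  proof (rule smooth_on_extension_by_zero[OF c assms(1,2)])
    fix p assume p: "p \<in> fst c" "p \<notin> chart_inv c0 ` cball a r"
    then have X0: "?X p = 0"
      using not_in_compact_support[OF assms(1)] assms(4) by simp
    then show "((\<lambda>p. tangent_comp A c p (?X p)) \<circ> chart_inv c) (snd c p) = 0"
      by (simp only: o_apply chart_inv_chart[OF c p(1)] X0 linear_0[OF linear_tangent_comp[OF c p(1)]])
  qed
qed

lemma ex_smooth_vector_field_through: "\<exists>X. smooth_vector_field A X \<and> X p = w"
proof -
  let ?c = "chart_at A p"
  have "snd ?c p \<in> chart_image ?c" using chart_at by blast
  then obtain \<psi> :: "real ^ 'n \<Rightarrow> real" and r where \<psi>: "r > 0" "cball (snd ?c p) r \<subseteq> chart_image ?c"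
    "smooth_on UNIV \<psi>" "\<psi> (snd ?c p) = 1" "\<And>x. x \<notin> cball (snd ?c p) r \<Longrightarrow> \<psi> x = 0"
    using smooth_bump_function[OF open_chart_image[OF chart_at(1)]] by metis
  have "frechet_derivative (snd ?c \<circ> chart_inv ?c) (at (snd ?c p)) w = w"
    using tangent_comp_chart_at[of p w] by (simp add: tangent_comp_def)
  then show ?thesis
    using smooth_vector_field_extension_by_zero[OF chart_at(1) \<psi>(2,3,5), of w] \<psi>(4) chart_at(2)[of p]
    by (intro exI[of _ "\<lambda>q. if q \<in> fst ?c then \<psi> (snd ?c q) *\<^sub>R
        frechet_derivative (snd (chart_at A q) \<circ> chart_inv ?c) (at (snd ?c q)) w else 0"]) simp
qed

lemma vf_through: "smooth_vector_field A (vf_through A p w)" "vf_through A p w p = w"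
  using someI_ex[OF ex_smooth_vector_field_through[of p w]] unfolding vf_through_def by auto

text \<open>The test function is the linear form x \<mapsto> (x - a) \<bullet> (u - v) in a chart,
  cut off by a bump. Its differential at \<open>p\<close> is the inner product with
  \<open>u - v\<close>, so equality on \<open>u\<close> and \<open>v\<close> forces the squared norm
  of \<open>u - v\<close> to be 0.\<close>

lemma tangent_vector_eqI:
  assumes eq: "\<And>h. smooth_function A h \<Longrightarrow> differential A h p u = differential A h p v"
  shows "u = v"
proof -
  let ?c = "chart_at A p" let ?a = "snd (chart_at A p) p"
  have a: "?a \<in> chart_image ?c" using chart_at by blast
  then obtain \<psi> :: "real ^ 'n \<Rightarrow> real" and r where \<psi>: "r > 0" "cball ?a r \<subseteq> chart_image ?c"
    "smooth_on UNIV \<psi>" "\<psi> ?a = 1" "\<And>x. x \<notin> cball ?a r \<Longrightarrow> \<psi> x = 0"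
    using smooth_bump_function[OF open_chart_image[OF chart_at(1)]] by metis
  define l where "l x = (x - ?a) \<bullet> (u - v)" for x
  have l: "smooth_on UNIV l"
    unfolding l_def by (rule smooth_on_bounded_linear[OF open_UNIV bounded_linear_inner_left
          smooth_on_diff[OF open_UNIV smooth_on_ident smooth_on_const]])
  have Dl: "frechet_derivative l (at x) w = w \<bullet> (u - v)" for x w
    unfolding l_def
    by (rule fun_cong[OF frechet_derivative_at[symmetric]]) (auto intro!: derivative_eq_intros)
  define F where "F x = \<psi> x *\<^sub>R l x" for x
  have F: "smooth_on UNIV F"
    unfolding F_def by (rule smooth_on_scaleR[OF open_UNIV \<psi>(3) l])
  \<comment> \<open>The form \<open>l\<close> vanishes at the centre and \<psi> is 1 there, so the
    derivative of \<psi> contributes nothing.\<close>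
  have DF: "frechet_derivative F (at ?a) w = w \<bullet> (u - v)" for w
    unfolding F_def using frechet_derivative_scaleR[OF smooth_on_differentiable[OF \<psi>(3) UNIV_I]
        smooth_on_differentiable[OF l UNIV_I]] Dl \<psi>(4) by (simp add: l_def)
  define h where "h q = (if q \<in> fst ?c then F (snd ?c q) else 0)" for q
  have h: "smooth_function A h"
    unfolding h_def using \<psi>(5)
    by (intro smooth_function_extension_by_zero[OF chart_at(1) \<psi>(2) F]) (simp add: F_def)
  have "frechet_derivative (h \<circ> chart_inv ?c) (at ?a) = frechet_derivative F (at ?a)"
    by (rule frechet_derivative_cong_open(1)[OF open_chart_image[OF chart_at(1)] a])
       (simp add: h_def chart_inv_in_domain chart_chart_inv)
  then have "differential A h p w = w \<bullet> (u - v)" for w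
    by (simp add: differential_def DF)
  then have "(u - v) \<bullet> (u - v) = 0"
    using eq[OF h] by (simp add: inner_diff_left)
  then show ?thesis by simp
qed


subsection \<open>The Lie bracket\<close>

definition bracket_rep ::
  "('m, 'n) chart \<Rightarrow> ('m \<Rightarrow> real ^ 'n) \<Rightarrow> ('m \<Rightarrow> real ^ 'n) \<Rightarrow> real ^ 'n \<Rightarrow> real ^ 'n" where
  "bracket_rep c X Y x = frechet_derivative (local_rep c Y) (at x) (local_rep c X x)
    - frechet_derivative (local_rep c X) (at x) (local_rep c Y x)"

lemma commutator_in_chart:
  assumes X: "smooth_vector_field A X" and Y: "smooth_vector_field A Y" and h: "smooth_function A h"
    and c: "c \<in> A" "p \<in> fst c"
  shows "vf_derivative A X (vf_derivative A Y h) p - vf_derivative A Y (vf_derivative A X h) p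
    = frechet_derivative (h \<circ> chart_inv c) (at (snd c p)) (bracket_rep c X Y (snd c p))"
proof -
  have x: "snd c p \<in> chart_image c" using c(2) by blast
  have *: "vf_derivative A V (vf_derivative A W h) p = frechet_derivative
      (\<lambda>y. frechet_derivative (h \<circ> chart_inv c) (at y) (local_rep c W y)) (at (snd c p))
      (local_rep c V (snd c p))"
    if "smooth_vector_field A V" "smooth_vector_field A W" for V W
  proof -
    have "vf_derivative A V (vf_derivative A W h) p = frechet_derivative
        (vf_derivative A W h \<circ> chart_inv c) (at (snd c p)) (local_rep c V (snd c p))"
      using vf_derivative_in_chart[OF smooth_function_vf_derivative[OF h that(2)] c(1) x, of V]
      by (simp add: chart_inv_chart[OF c])
    also have "frechet_derivative (vf_derivative A W h \<circ> chart_inv c) (at (snd c p))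
        = frechet_derivative (\<lambda>y. frechet_derivative (h \<circ> chart_inv c) (at y) (local_rep c W y))
          (at (snd c p))"
      by (intro frechet_derivative_cong_open(1)[OF open_chart_image[OF c(1)] x]
          vf_derivative_in_chart h c(1))
    finally show ?thesis .
  qed
  have "smooth_on (chart_image c) (h \<circ> chart_inv c)"
    using h c(1) by (simp add: smooth_function_def)
  then show ?thesis
    unfolding *[OF X Y] *[OF Y X] bracket_rep_def
    by (intro frechet_derivative_commutator[OF open_chart_image[OF c(1)] x]
        smooth_on_local_rep X Y c(1))
qed

text \<open>Justifies the definite description in \<open>lie_bracket\<close>. The candidate is the
  coordinate bracket taken, at each point, in the chart chosen there; uniqueness holds because
  smooth functions separate tangent vectors.\<close>

lemma ex1_lie_bracket:
  assumes X: "smooth_vector_field A X" and Y: "smooth_vector_field A Y"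
  shows "\<exists>!Z. smooth_vector_field A Z \<and> (\<forall>h. smooth_function A h \<longrightarrow>
    (\<forall>p. vf_derivative A Z h p
      = vf_derivative A X (vf_derivative A Y h) p - vf_derivative A Y (vf_derivative A X h) p))"
proof (rule ex_ex1I)
  define Z where "Z p = bracket_rep (chart_at A p) X Y (snd (chart_at A p) p)" for p
  have Zh: "vf_derivative A Z h p
      = vf_derivative A X (vf_derivative A Y h) p - vf_derivative A Y (vf_derivative A X h) p"
    if "smooth_function A h" for h p
    unfolding commutator_in_chart[OF X Y that chart_at]
    by (simp add: vf_derivative_def differential_def Z_def)
  \<comment> \<open>The chosen chart jumps from point to point, so smoothness must be checked in a
    fixed \<open>c\<close>. The vector with components \<open>bracket_rep c X Y\<close> acts on
    functions as the same commutator, hence equals \<open>Z p\<close>.\<close>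
  have Z: "tangent_comp A c p (Z p) = bracket_rep c X Y (snd c p)" if c: "c \<in> A" "p \<in> fst c" for c p
  proof -
    obtain v where v: "tangent_comp A c p v = bracket_rep c X Y (snd c p)"
      using tangent_comp_of_chart_at[OF c(1,1) c(2,2), of "bracket_rep c X Y (snd c p)"]
        frechet_derivative_chart_self[OF c] by metis
    have "Z p = v"
    proof (rule tangent_vector_eqI)
      fix h assume h: "smooth_function A h"
      show "differential A h p (Z p) = differential A h p v"
        using Zh[OF h, of p] commutator_in_chart[OF X Y h c]
          differential_in_chart[OF c smooth_function_differentiable[OF h c], of v] v
        by (simp add: vf_derivative_def)
    qed
    then show ?thesis using v by simp
  qed
  have "smooth_vector_field A Z"
    unfolding smooth_vector_field_def
  proof
    fix c assume c: "c \<in> A"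
    have "smooth_on (chart_image c) (bracket_rep c X Y)"
      unfolding bracket_rep_def
      by (intro smooth_on_diff smooth_on_frechet_derivative smooth_on_local_rep
          open_chart_image X Y c)
    then show "smooth_on (chart_image c) ((\<lambda>p. tangent_comp A c p (Z p)) \<circ> chart_inv c)"
      by (rule smooth_on_cong_open[OF open_chart_image[OF c], rotated])
         (simp add: Z[OF c chart_inv_in_domain] chart_chart_inv)
  qed
  with Zh show "\<exists>Z. smooth_vector_field A Z \<and> (\<forall>h. smooth_function A h \<longrightarrow> (\<forall>p. vf_derivative A Z h p
      = vf_derivative A X (vf_derivative A Y h) p - vf_derivative A Y (vf_derivative A X h) p))"
    by blast
next
  fix Z Z'
  assume *: "smooth_vector_field A Z \<and> (\<forall>h. smooth_function A h \<longrightarrow> (\<forall>p. vf_derivative A Z h p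
      = vf_derivative A X (vf_derivative A Y h) p - vf_derivative A Y (vf_derivative A X h) p))"
    "smooth_vector_field A Z' \<and> (\<forall>h. smooth_function A h \<longrightarrow> (\<forall>p. vf_derivative A Z' h p
      = vf_derivative A X (vf_derivative A Y h) p - vf_derivative A Y (vf_derivative A X h) p))"
  show "Z = Z'"
  proof
    fix p
    show "Z p = Z' p"
      by (rule tangent_vector_eqI[of p]) (use * in \<open>simp add: vf_derivative_def\<close>)
  qed
qed

lemma
  assumes "smooth_vector_field A X" "smooth_vector_field A Y"
  shows smooth_vector_field_lie_bracket: "smooth_vector_field A (lie_bracket A X Y)"
    and vf_derivative_lie_bracket: "smooth_function A h \<Longrightarrow> vf_derivative A (lie_bracket A X Y) h p
      = vf_derivative A X (vf_derivative A Y h) p - vf_derivative A Y (vf_derivative A X h) p"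
  using theI'[OF ex1_lie_bracket[OF assms]] unfolding lie_bracket_def by blast+

end

section \<open>Functions with vanishing differential\<close>

context smooth_manifold
begin

lemma frechet_derivative_chart_eq_0:
  assumes h: "smooth_function A h" and 0: "\<And>p v. differential A h p v = 0"
    and c: "c \<in> A" "p \<in> fst c"
  shows "frechet_derivative (h \<circ> chart_inv c) (at (snd c p)) v = 0"
proof -
  obtain w where "tangent_comp A c p w = v"
    using tangent_comp_of_chart_at[OF c(1,1) c(2,2), of v] frechet_derivative_chart_self[OF c] by metis
  then show ?thesis
    using differential_in_chart[OF c smooth_function_differentiable[OF h c], of w] 0 by simp
qed

text \<open>A chart preimage of a ball is a neighbourhood on which \<open>h\<close> is constant, by
  convexity of the ball; connectedness then makes \<open>h\<close> globally constant.\<close>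

lemma differential_zero_imp_constant:
  assumes "connected (UNIV :: 'm set)" "smooth_function A h" "\<And>p v. differential A h p v = 0"
  shows "\<exists>k. \<forall>p. h p = k"
proof -
  have "h constant_on UNIV"
  proof (rule locally_constant_imp_constant[OF assms(1)])
    fix a :: 'm
    let ?c = "chart_at A a"
    note c = chart_at(1)[of a]
    have a: "snd ?c a \<in> chart_image ?c" using chart_at by blast
    then obtain e where e: "e > 0" "ball (snd ?c a) e \<subseteq> chart_image ?c"
      using open_chart_image[OF c] openE by blast
    let ?T = "fst ?c \<inter> snd ?c -` ball (snd ?c a) e"
    have T: "open ?T"
      by (rule continuous_open_preimage[OF homeomorphism_cont1[OF chart_homeomorphism[OF c]]
            open_chart_domain[OF c] open_ball])
    have const: "h q = h a" if q: "q \<in> ?T" for q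
    proof -
      have "((h \<circ> chart_inv ?c) has_derivative (\<lambda>_. 0)) (at x within ball (snd ?c a) e)"
        if x: "x \<in> ball (snd ?c a) e" for x
      proof -
        obtain p where p: "p \<in> fst ?c" "x = snd ?c p" using e(2) x by blast
        then have "frechet_derivative (h \<circ> chart_inv ?c) (at x) = (\<lambda>_. 0)"
          using frechet_derivative_chart_eq_0[OF assms(2,3) c p(1)] by auto
        then show ?thesis
          using has_derivative_frechet_derivative[OF smooth_function_differentiable[OF assms(2) c p(1)]]
          by (simp add: p(2) has_derivative_at_withinI)
      qed
      then have "(h \<circ> chart_inv ?c) (snd ?c q) = (h \<circ> chart_inv ?c) (snd ?c a)"
        using q e(1) by (intro has_derivative_zero_unique[OF convex_ball[of "snd ?c a" e]]) (auto simp: o_def)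
      then show ?thesis
        using q chart_at(2)[of a] by (simp add: chart_inv_chart[OF c])
    qed
    have "a \<in> ?T" using e(1) chart_at(2)[of a] by simp
    with T const show "\<exists>T. openin (top_of_set UNIV) T \<and> a \<in> T \<and> (\<forall>x\<in>T. h x = h a)"
      by (metis open_openin subtopology_UNIV)
  qed
  then show ?thesis by (auto simp: constant_on_def)
qed

end


subsection \<open>Curvature of a torsion-free connection\<close>

text \<open>\<open>matrix\<close> reads a map only at the vectors \<open>axis i 1\<close>, so the
  trace rules hold for arbitrary maps. Thus \<open>ricci\<close> inherits additivity and homogeneity
  in its last argument from the curvature, entry by entry.\<close>

lemma trace_matrix_add: "trace (matrix (\<lambda>u. F u + G u)) = trace (matrix F) + trace (matrix G)"
  for F G :: "real ^ 'n \<Rightarrow> real ^ 'n::finite"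
  by (simp add: trace_def matrix_def sum.distrib)

lemma trace_matrix_scaleR: "trace (matrix (\<lambda>u. k *\<^sub>R F u)) = k * trace (matrix F)"
  for F :: "real ^ 'n \<Rightarrow> real ^ 'n::finite"
  by (simp add: trace_def matrix_def sum_distrib_left)

locale torsion_free_manifold = smooth_manifold A
  for A :: "('m::{t2_space, second_countable_topology}, 'n::finite) chart set" +
  fixes D :: "('m, 'n) connection"
  assumes affine: "affine_connection A D"
    and torsion: "torsion_free A D"
begin

lemma
  assumes "smooth_vector_field A X" "smooth_vector_field A Y"
  shows smooth_vector_field_connection: "smooth_vector_field A (D X Y)"
    and connection_scaleR_left:
      "smooth_function A h \<Longrightarrow> D (\<lambda>p. h p *\<^sub>R X p) Y = (\<lambda>p. h p *\<^sub>R D X Y p)"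
    and connection_scaleR_right: "smooth_function A h \<Longrightarrow>
      D X (\<lambda>p. h p *\<^sub>R Y p) = (\<lambda>p. vf_derivative A X h p *\<^sub>R Y p + h p *\<^sub>R D X Y p)"
  using affine assms unfolding affine_connection_def by auto

lemma connection_add_right:
  assumes "smooth_vector_field A X" "smooth_vector_field A Y" "smooth_vector_field A Z"
  shows "D X (\<lambda>p. Y p + Z p) = (\<lambda>p. D X Y p + D X Z p)"
  using affine assms unfolding affine_connection_def by auto

lemma connection_diff_right:
  assumes "smooth_vector_field A X" "smooth_vector_field A Y" "smooth_vector_field A Z"
  shows "D X (\<lambda>p. Y p - Z p) = (\<lambda>p. D X Y p - D X Z p)"
  using connection_add_right[OF assms(1) smooth_vector_field_diff[OF assms(2,3)] assms(3)]
  by (simp add: fun_eq_iff)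

lemma lie_bracket_eq:
  assumes "smooth_vector_field A X" "smooth_vector_field A Y"
  shows "lie_bracket A X Y = (\<lambda>p. D X Y p - D Y X p)"
  using torsion assms unfolding torsion_free_def by auto

lemma curvature_add:
  assumes X: "smooth_vector_field A X" and Y: "smooth_vector_field A Y"
    and Z: "smooth_vector_field A Z" and W: "smooth_vector_field A W"
  shows "curvature A D X Y (\<lambda>q. Z q + W q) p = curvature A D X Y Z p + curvature A D X Y W p"
  unfolding curvature_def
  by (simp add: connection_add_right X Y Z W smooth_vector_field_connection
      smooth_vector_field_lie_bracket)

text \<open>First-order terms in \<open>h\<close> cancel under exchange of \<open>X\<close> and
  \<open>Y\<close>, apart from the commutator of \<open>X\<close> and \<open>Y\<close> on
  \<open>h\<close>; the bracket term of the curvature cancels that one.\<close>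

lemma curvature_scaleR:
  assumes X: "smooth_vector_field A X" and Y: "smooth_vector_field A Y"
    and Z: "smooth_vector_field A Z" and h: "smooth_function A h"
  shows "curvature A D X Y (\<lambda>q. h q *\<^sub>R Z q) p = h p *\<^sub>R curvature A D X Y Z p"
proof -
  have DD: "D V (D W (\<lambda>q. h q *\<^sub>R Z q)) p
      = vf_derivative A V (vf_derivative A W h) p *\<^sub>R Z p + vf_derivative A W h p *\<^sub>R D V Z p
        + (vf_derivative A V h p *\<^sub>R D W Z p + h p *\<^sub>R D V (D W Z) p)"
    if "smooth_vector_field A V" "smooth_vector_field A W" for V W
    by (simp add: connection_scaleR_right connection_add_right that Z h smooth_vector_field_connection
        smooth_vector_field_scaleR smooth_function_vf_derivative)
  show ?thesis
    unfolding curvature_def DD[OF X Y] DD[OF Y X]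
    by (simp add: connection_scaleR_right smooth_vector_field_lie_bracket X Y Z h
        vf_derivative_lie_bracket algebra_simps)
qed

lemma ricci_add:
  assumes "smooth_vector_field A Y" "smooth_vector_field A Z" "smooth_vector_field A W"
  shows "ricci A D Y (\<lambda>q. Z q + W q) p = ricci A D Y Z p + ricci A D Y W p"
  unfolding ricci_def curvature_add[OF vf_through(1) assms] by (rule trace_matrix_add)

lemma ricci_scaleR:
  assumes "smooth_vector_field A Y" "smooth_vector_field A Z" "smooth_function A h"
  shows "ricci A D Y (\<lambda>q. h q *\<^sub>R Z q) p = h p * ricci A D Y Z p"
  unfolding ricci_def curvature_scaleR[OF vf_through(1) assms] by (rule trace_matrix_scaleR)

lemma ricci_diff:
  assumes "smooth_vector_field A Y" "smooth_vector_field A Z" "smooth_vector_field A W"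
  shows "ricci A D Y (\<lambda>q. Z q - W q) p = ricci A D Y Z p - ricci A D Y W p"
  using ricci_add[OF assms(1) smooth_vector_field_diff[OF assms(2,3)] assms(3), of p] by simp

end


subsection \<open>Ricci symmetric \<open>f\<close>-Kenmotsu manifolds\<close>

locale f_kenmotsu =
  fixes A :: "('m::{t2_space, second_countable_topology}, 'n::finite) chart set"
    and \<phi> :: "'m \<Rightarrow> real ^ 'n \<Rightarrow> real ^ 'n"
    and \<xi> :: "'m \<Rightarrow> real ^ 'n"
    and \<eta> :: "'m \<Rightarrow> real ^ 'n \<Rightarrow> real"
    and g :: "'m \<Rightarrow> real ^ 'n \<Rightarrow> real ^ 'n \<Rightarrow> real"
    and D :: "('m, 'n) connection"
    and f :: "'m \<Rightarrow> real"
  assumes f_kenmotsu: "f_kenmotsu_manifold A \<phi> \<xi> \<eta> g D f"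
begin

lemma almost_contact: "almost_contact_metric_manifold A \<phi> \<xi> \<eta> g"
  and levi_civita: "levi_civita_connection A g D"
  and smooth_f: "smooth_function A f"
  and f_pos: "0 < f p"
  using f_kenmotsu unfolding f_kenmotsu_manifold_def by auto

lemma smooth_xi: "smooth_vector_field A \<xi>"
  and linear_phi: "linear (\<phi> p)"
  and linear_eta: "linear (\<eta> p)"
  and phi_phi: "\<phi> p (\<phi> p u) = - u + \<eta> p u *\<^sub>R \<xi> p"
  and eta_xi: "\<eta> p (\<xi> p) = 1"
  and eta_phi: "\<eta> p (\<phi> p u) = 0"
  and phi_xi: "\<phi> p (\<xi> p) = 0"
  and eta_eq: "\<eta> p u = g p u (\<xi> p)"
  using almost_contact
  unfolding almost_contact_metric_manifold_def one_form_def endomorphism_field_def by auto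

lemma smooth_eta: "smooth_vector_field A X \<Longrightarrow> smooth_function A (\<lambda>p. \<eta> p (X p))"
  using almost_contact unfolding almost_contact_metric_manifold_def one_form_def by auto

lemma metric_sym: "g p u v = g p v u"
  and bilinear_metric: "bilinear (g p)"
  using almost_contact
  unfolding almost_contact_metric_manifold_def riemannian_metric_def by auto

sublocale torsion_free_manifold A D
  using almost_contact levi_civita
  by unfold_locales (auto simp: almost_contact_metric_manifold_def levi_civita_connection_def)

lemmas smooth_closure = smooth_xi smooth_f smooth_eta smooth_function_add smooth_function_mult
  smooth_function_const smooth_vector_field_add smooth_vector_field_diff smooth_vector_field_scaleR
  smooth_function_vf_derivative smooth_vector_field_connection smooth_vector_field_lie_bracket

section \<open>Covariant derivatives of \<xi> and \<eta>\<close>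

lemma vf_derivative_metric:
  assumes "smooth_vector_field A X" "smooth_vector_field A Y" "smooth_vector_field A Z"
  shows "vf_derivative A X (\<lambda>q. g q (Y q) (Z q)) p = g p (D X Y p) (Z p) + g p (Y p) (D X Z p)"
  using levi_civita assms unfolding levi_civita_connection_def metric_connection_def by blast

text \<open>Differentiate g(\<xi>, \<xi>) = 1.\<close>

lemma eta_connection_xi:
  assumes "smooth_vector_field A X"
  shows "\<eta> p (D X \<xi> p) = 0"
proof -
  have "(\<lambda>q. g q (\<xi> q) (\<xi> q)) = (\<lambda>q. 1)"
    using eta_xi eta_eq by simp
  then have "vf_derivative A X (\<lambda>q. g q (\<xi> q) (\<xi> q)) p = 0"
    by (simp add: vf_derivative_def differential_const)
  then show ?thesis
    using vf_derivative_metric[OF assms smooth_xi smooth_xi, of p] metric_sym[of p "\<xi> p"]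
    by (simp add: eta_eq)
qed

text \<open>At \<open>Y = \<xi>\<close> the defining identity yields only \<phi> of the claim,
  because \<phi> kills \<xi>. Applying \<phi> again recovers the part orthogonal to \<xi>; the
  \<xi>-component vanishes by \<open>eta_connection_xi\<close>.\<close>

lemma connection_xi:
  assumes X: "smooth_vector_field A X"
  shows "D X \<xi> = (\<lambda>p. f p *\<^sub>R (X p - \<eta> p (X p) *\<^sub>R \<xi> p))"
proof
  fix p
  \<comment> \<open>The zero field \<phi> \<xi> is written as a multiple of \<xi> so that the
    Leibniz rule computes its derivative.\<close>
  have "D X (\<lambda>q. 0 *\<^sub>R \<xi> q) p = 0"
    unfolding connection_scaleR_right[OF X smooth_xi smooth_function_const]
    by (simp add: vf_derivative_def differential_const)
  moreover have "D X (\<lambda>q. \<phi> q (\<xi> q)) p - \<phi> p (D X \<xi> p)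
      = f p *\<^sub>R (g p (\<phi> p (X p)) (\<xi> p) *\<^sub>R \<xi> p - \<eta> p (\<xi> p) *\<^sub>R \<phi> p (X p))"
    using f_kenmotsu X smooth_xi unfolding f_kenmotsu_manifold_def by blast
  ultimately have "\<phi> p (D X \<xi> p) = f p *\<^sub>R \<phi> p (X p)"
    by (simp add: phi_xi eta_xi eta_phi flip: eta_eq)
  then have "\<phi> p (\<phi> p (D X \<xi> p)) = f p *\<^sub>R \<phi> p (\<phi> p (X p))"
    by (simp add: linear_scale[OF linear_phi])
  then show "D X \<xi> p = f p *\<^sub>R (X p - \<eta> p (X p) *\<^sub>R \<xi> p)"
    by (simp add: phi_phi eta_connection_xi[OF X] algebra_simps)
qed

text \<open>The term with \<open>f\<close> is symmetric in \<open>X\<close> and \<open>Y\<close>, so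
  antisymmetrising leaves \<eta>([X, Y]): this is closedness of \<eta>.\<close>

lemma vf_derivative_eta:
  assumes X: "smooth_vector_field A X" and Y: "smooth_vector_field A Y"
  shows "vf_derivative A X (\<lambda>q. \<eta> q (Y q)) p
    = \<eta> p (D X Y p) + f p * (g p (X p) (Y p) - \<eta> p (X p) * \<eta> p (Y p))"
  using vf_derivative_metric[OF X Y smooth_xi, of p] metric_sym[of p "Y p" "X p"]
  by (simp add: eta_eq connection_xi[OF X] bilinear_rmul[OF bilinear_metric]
      bilinear_rsub[OF bilinear_metric] algebra_simps)

section \<open>The derivative of f along \<xi>\<close>

definition f' :: "'m \<Rightarrow> real" where
  "f' = vf_derivative A \<xi> f"

lemma smooth_f': "smooth_function A f'"
  unfolding f'_def by (intro smooth_closure)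

text \<open>Evaluate df \<and> \<eta> = 0 on the pair (v, \<xi>).\<close>

lemma differential_f: "differential A f p v = f' p * \<eta> p v"
proof -
  have "wedge (differential A f) \<eta> p v (\<xi> p) = 0"
    using f_kenmotsu unfolding f_kenmotsu_manifold_def by blast
  then show ?thesis by (simp add: wedge_def eta_xi f'_def vf_derivative_def)
qed

lemma vf_derivative_f: "vf_derivative A X f p = f' p * \<eta> p (X p)"
  by (simp add: vf_derivative_def differential_f)

text \<open>This is the equation \<open>d(df) = 0\<close>, in view of \<open>df = f' \<eta>\<close> and \<open>d\<eta> = 0\<close>.\<close>

lemma vf_derivative_f':
  assumes X: "smooth_vector_field A X"
  shows "vf_derivative A X f' p = vf_derivative A \<xi> f' p * \<eta> p (X p)"
proof -
  have D: "vf_derivative A V (vf_derivative A W f) p = vf_derivative A V f' p * \<eta> p (W p)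
      + f' p * (\<eta> p (D V W p) + f p * (g p (V p) (W p) - \<eta> p (V p) * \<eta> p (W p)))"
    if "smooth_vector_field A V" "smooth_vector_field A W" for V W
  proof -
    have "vf_derivative A W f = (\<lambda>q. f' q * \<eta> q (W q))"
      by (simp add: fun_eq_iff vf_derivative_f)
    then show ?thesis
      using differential_mult[OF smooth_f' smooth_eta[OF that(2)], of p "V p"]
        vf_derivative_eta[OF that, of p] by (simp add: vf_derivative_def)
  qed
  have "f' p * (\<eta> p (D X \<xi> p) - \<eta> p (D \<xi> X p))
      = vf_derivative A X (vf_derivative A \<xi> f) p - vf_derivative A \<xi> (vf_derivative A X f) p"
    using vf_derivative_lie_bracket[OF X smooth_xi smooth_f, of p]
    by (simp add: vf_derivative_f lie_bracket_eq X smooth_xi linear_diff[OF linear_eta])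
  then show ?thesis
    unfolding D[OF X smooth_xi] D[OF smooth_xi X] using metric_sym[of p "X p" "\<xi> p"]
    by (simp add: eta_xi algebra_simps)
qed

text \<open>\<open>DD\<close> differentiates the formula for the derivative of \<xi>. On exchanging
  \<open>X\<close> and \<open>Y\<close> the metric term drops out by symmetry, and the terms with
  \<open>D X Y\<close> cancel against the bracket by vanishing torsion. The rest splits into an f^2
  part and an \<open>f'\<close> part.\<close>

lemma curvature_xi:
  assumes X: "smooth_vector_field A X" and Y: "smooth_vector_field A Y"
  shows "curvature A D X Y \<xi> p
    = ((f p)\<^sup>2 + f' p) *\<^sub>R (\<eta> p (X p) *\<^sub>R Y p - \<eta> p (Y p) *\<^sub>R X p)"
proof -
  have DD: "D V (D W \<xi>) p = (f' p * \<eta> p (V p)) *\<^sub>R (W p - \<eta> p (W p) *\<^sub>R \<xi> p)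
      + f p *\<^sub>R (D V W p - ((\<eta> p (D V W p) + f p * (g p (V p) (W p) - \<eta> p (V p) * \<eta> p (W p))) *\<^sub>R \<xi> p
        + \<eta> p (W p) *\<^sub>R f p *\<^sub>R (V p - \<eta> p (V p) *\<^sub>R \<xi> p)))"
    if V: "smooth_vector_field A V" and W: "smooth_vector_field A W" for V W
    using V W
    by (simp add: connection_xi connection_scaleR_right connection_diff_right smooth_closure
        vf_derivative_f vf_derivative_eta)
  show ?thesis
    unfolding curvature_def DD[OF X Y] DD[OF Y X] connection_xi[OF smooth_vector_field_lie_bracket[OF X Y]]
    using metric_sym[of p "X p" "Y p"]
    by (simp add: lie_bracket_eq[OF X Y] linear_diff[OF linear_eta] vec_eq_iff power2_eq_square
        algebra_simps)
qed

text \<open>The square is written as a product because the smoothness and differential rules are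
  stated for sums and products.\<close>

definition \<rho> :: "'m \<Rightarrow> real" where
  "\<rho> p = (1 - real CARD('n)) * (f p * f p + f' p)"

text \<open>In the trace of u \<mapsto> \<eta>(u) Y - \<eta>(Y) u the rank-one part contributes
  \<eta>(Y) and the identity contributes \<open>CARD('n)\<close> times \<eta>(Y).\<close>

lemma ricci_xi:
  assumes Y: "smooth_vector_field A Y"
  shows "ricci A D Y \<xi> p = \<rho> p * \<eta> p (Y p)"
proof -
  have "(\<Sum>i\<in>UNIV. \<eta> p (axis i 1) * Y p $ i) = \<eta> p (\<Sum>i\<in>UNIV. Y p $ i *s axis i 1)"
    by (simp add: linear_sum[OF linear_eta] linear_scale[OF linear_eta] scalar_mult_eq_scaleR
        mult.commute)
  then have "(\<Sum>i\<in>UNIV. \<eta> p (axis i 1) * Y p $ i) = \<eta> p (Y p)"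
    by (simp add: basis_expansion)
  then have "trace (matrix (\<lambda>u. \<eta> p u *\<^sub>R Y p - \<eta> p (Y p) *\<^sub>R u)) = (1 - real CARD('n)) * \<eta> p (Y p)"
    by (simp add: trace_def matrix_def sum_subtractf algebra_simps)
  then show ?thesis
    unfolding ricci_def curvature_xi[OF vf_through(1) Y] vf_through(2)
    by (simp add: trace_matrix_scaleR \<rho>_def power2_eq_square)
qed

lemma smooth_rho: "smooth_function A \<rho>"
  unfolding \<rho>_def by (intro smooth_closure smooth_f')

section \<open>Consequences of parallel Ricci tensor\<close>

context
  assumes symmetric: "locally_ricci_symmetric A D"
begin

text \<open>The terms \<rho> \<eta>(D X Y) cancel directly. The term f \<rho> \<eta>(X) \<eta>(Y)
  occurs both in X(\<rho> \<eta>(Y)) and in S(Y, D X \<xi>), and these two cancel as well.\<close>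

lemma ricci_symmetric_xi:
  assumes X: "smooth_vector_field A X" and Y: "smooth_vector_field A Y"
  shows "vf_derivative A X \<rho> p * \<eta> p (Y p) + f p * \<rho> p * g p (X p) (Y p) = f p * ricci A D Y X p"
proof -
  have "ricci A D Y \<xi> = (\<lambda>q. \<rho> q * \<eta> q (Y q))"
    using ricci_xi[OF Y] by auto
  then have "vf_derivative A X (ricci A D Y \<xi>) p = vf_derivative A X \<rho> p * \<eta> p (Y p)
      + \<rho> p * (\<eta> p (D X Y p) + f p * (g p (X p) (Y p) - \<eta> p (X p) * \<eta> p (Y p)))"
    using differential_mult[OF smooth_rho smooth_eta[OF Y], of p "X p"]
      vf_derivative_eta[OF X Y, of p] by (simp add: vf_derivative_def)
  moreover have "ricci A D Y (D X \<xi>) p = f p * (ricci A D Y X p - \<eta> p (X p) * (\<rho> p * \<eta> p (Y p)))"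
    using X Y by (simp add: connection_xi ricci_scaleR ricci_diff ricci_xi smooth_closure)
  moreover have "ricci A D (D X Y) \<xi> p = \<rho> p * \<eta> p (D X Y p)"
    using X Y by (simp add: ricci_xi smooth_closure)
  moreover have "vf_derivative A X (ricci A D Y \<xi>) p
      - ricci A D (D X Y) \<xi> p - ricci A D Y (D X \<xi>) p = 0"
    using symmetric X Y smooth_xi unfolding locally_ricci_symmetric_def by blast
  ultimately show ?thesis
    by (simp add: algebra_simps)
qed

text \<open>By \<open>*\<close> the differential of \<rho> is a multiple of \<eta> at each point, so
  it vanishes as soon as it vanishes on \<xi>.\<close>

lemma vf_derivative_rho:
  assumes X: "smooth_vector_field A X"
  shows "vf_derivative A X \<rho> p = 0"
proof -
  have *: "vf_derivative A V \<rho> p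
      = (1 - real CARD('n)) * (2 * f p * f' p + vf_derivative A \<xi> f' p) * \<eta> p (V p)"
    if "smooth_vector_field A V" for V
    using vf_derivative_f'[OF that, of p] unfolding \<rho>_def[abs_def] vf_derivative_def
    by (simp add: differential_mult differential_add differential_const smooth_closure smooth_f'
        differential_f) (simp add: algebra_simps)
  \<comment> \<open>Here S(\<xi>, \<xi>) = \<rho> and g(\<xi>, \<xi>) = 1, so both sides contain the
    same term f \<rho>.\<close>
  have "vf_derivative A \<xi> \<rho> p = 0"
    using ricci_symmetric_xi[OF smooth_xi smooth_xi, of p] ricci_xi[OF smooth_xi, of p]
      eta_eq[of p "\<xi> p"] by (simp add: eta_xi)
  then show ?thesis
    using *[OF smooth_xi] *[OF X] by (simp add: eta_xi)
qed

lemma einstein: "einstein A g D"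
proof -
  have "differential A \<rho> p v = 0" for p v
    using vf_derivative_rho[OF vf_through(1)[of p v], of p]
    by (simp add: vf_derivative_def vf_through(2))
  then obtain k where k: "\<And>p. \<rho> p = k"
    using differential_zero_imp_constant[OF _ smooth_rho] almost_contact
    unfolding almost_contact_metric_manifold_def by blast
  \<comment> \<open>\<open>Z\<close> takes the differentiation slot, so that \<open>ricci\<close>
    appears with its arguments in this order; then f > 0 is cancelled.\<close>
  have "ricci A D Y Z p = k * g p (Y p) (Z p)"
    if "smooth_vector_field A Y" "smooth_vector_field A Z" for Y Z p
    using ricci_symmetric_xi[OF that(2,1), of p] vf_derivative_rho[OF that(2), of p] f_pos[of p]
      metric_sym[of p "Y p" "Z p"] by (simp add: k)
  then show ?thesis unfolding einstein_def by blast
qed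

end

end

theorem corollary1:
  fixes A :: "('m::{t2_space, second_countable_topology}, 'n::finite) chart set"
    and \<phi> :: "'m \<Rightarrow> real ^ 'n \<Rightarrow> real ^ 'n"
    and \<xi> :: "'m \<Rightarrow> real ^ 'n"
    and \<eta> :: "'m \<Rightarrow> real ^ 'n \<Rightarrow> real"
    and g :: "'m \<Rightarrow> real ^ 'n \<Rightarrow> real ^ 'n \<Rightarrow> real"
    and D :: "('m, 'n) connection"
    and f :: "'m \<Rightarrow> real"
  assumes "regular_f_kenmotsu_manifold A \<phi> \<xi> \<eta> g D f"
    and "locally_ricci_symmetric A D"
  shows "einstein A g D"
proof -
  interpret f_kenmotsu A \<phi> \<xi> \<eta> g D f
    using assms(1) by (simp add: f_kenmotsu_def regular_f_kenmotsu_manifold_def)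
  show ?thesis by (rule einstein[OF assms(2)])
qed

end
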